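(* Let $p>3$ be a prime. Then $$\sum_{k=1}^{p-1}\frac{(-1)^k}k\binom{-1/6}k\equiv 2q_p(2)+\frac 32q_p(3)-pq_p(2)^2-\frac 34pq_p(3)^2-\frac 52\Big(3-2\Big(\frac{-3}p\Big)\Big)pU_{p-3}\pmod{p^2}.$$
   Context: For $x,y\in\mathbb Q$ with denominators prime to $p$, $x\equiv y\pmod{p^m}$ means $(x-y)/p^m$ has denominator prime to $p$. For rational $a$ and integer $k\ge0$, $\binom ak=a(a-1)\cdots(a-k+1)/k!$. $q_p(a)=(a^{p-1}-1)/p$ is the Fermat quotient, $\big(\frac{-3}p\big)$ the Legendre symbol. The sequence $\{U_n\}$ is defined by $U_0=1$ and $U_n=-2\sum_{k=1}^{[n/2]}\binom n{2k}U_{n-2k}$ for $n\ge1$. *)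

theory Defs
  imports Complex_Main "HOL-Number_Theory.Number_Theory"
begin

definition denom_prime_to :: "nat \<Rightarrow> rat \<Rightarrow> bool" where
  "denom_prime_to p x \<longleftrightarrow> coprime (snd (quotient_of x)) (int p)"

text \<open>
  The congruence of \<open>x\<close> and \<open>y\<close> modulo \<open>p\<^sup>m\<close> is only meaningful for rationals with denominators
  prime to \<open>p\<close>; this proviso is part of the predicate.
\<close>

definition rat_cong :: "nat \<Rightarrow> nat \<Rightarrow> rat \<Rightarrow> rat \<Rightarrow> bool" where
  "rat_cong p m x y \<longleftrightarrow>
     denom_prime_to p x \<and> denom_prime_to p y \<and> denom_prime_to p ((x - y) / of_nat p ^ m)"

definition fermat_quotient :: "nat \<Rightarrow> int \<Rightarrow> rat" where
  "fermat_quotient p a = (of_int a ^ (p - 1) - 1) / of_nat p"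

function U_seq :: "nat \<Rightarrow> int" where
  "U_seq n = (if n = 0 then 1
     else - 2 * (\<Sum>k = 1..n div 2. int (n choose (2 * k)) * U_seq (n - 2 * k)))"
  by auto
termination by (relation "measure id") auto

declare U_seq.simps [simp del]

end

theory Submission
  imports Defs "HOL-Computational_Algebra.Formal_Power_Series"
begin

text \<open>
  Let \<open>S a\<close> be the sum with \<open>-1/6\<close> replaced by \<open>a\<close>, and let \<open>H N\<close> and \<open>X N\<close> be the sums of \<open>1/k\<close> and of
  \<open>1/k\<^sup>2\<close> over \<open>1 \<le> k \<le> N\<close>. Pascal's rule gives \<open>S a - S (a - 1) = (C(a - 1, p - 1) - 1)/a\<close>, hence
  \<open>S (r + p t) \<equiv> - H r + 2 p t X r\<close> modulo \<open>p\<^sup>2\<close> for \<open>0 \<le> r < p\<close>. Writing \<open>-1/6 = r + p t\<close> and using the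
  symmetry \<open>k \<mapsto> p - k\<close>, everything is reduced to \<open>H\<close> and \<open>X\<close> at \<open>m = \<lfloor>p/6\<rfloor>\<close>.

  Splitting according to the parity of \<open>k\<close> expresses \<open>H m\<close> by \<open>H \<lfloor>p/2\<rfloor>\<close> and \<open>H \<lfloor>p/3\<rfloor>\<close>. These are given by
  Fermat quotients: the residues of \<open>n k\<close> modulo \<open>p\<close> are a permutation of \<open>1, \<dots>, p - 1\<close>, and comparing the two
  products modulo \<open>p\<^sup>3\<close> yields \<open>q\<^sub>p(n)\<close> in terms of the numbers \<open>\<lfloor>n k/p\<rfloor>/(n k)\<close>.

  Finally \<open>X m\<close> is related modulo \<open>p\<close> to the alternating sum of \<open>(3 l)\<^sup>p\<^sup>-\<^sup>3\<close> over \<open>l \<le> p/3\<close>. The Appell polynomials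
  \<open>G\<close> of the sequence \<open>U\<close> satisfy \<open>G(x + 3) + G(x) = (x + 1)\<^sup>n + (x + 2)\<^sup>n\<close>, so this sum telescopes to
  a difference of \<open>G(\<plusminus>1) = U\<^sub>n/2\<close> and \<open>G(p) \<equiv> U\<^sub>n\<close>.
\<close>

section \<open>The sequence U, its generating function and its Appell polynomials\<close>

unbundle fps_syntax

definition U_fps :: "rat fps" where
  "U_fps = Abs_fps (\<lambda>n. of_int (U_seq n) / fact n)"

lemma U_fps_nth [simp]: "U_fps $ n = of_int (U_seq n) / fact n"
  by (simp add: U_fps_def)

lemma U_seq_0: "U_seq 0 = 1"
  by (subst U_seq.simps) simp

text \<open>The recursion only links indices of equal parity, so from an odd index it never reaches
  the value 1 at 0.\<close>

lemma U_seq_odd: "odd n \<Longrightarrow> U_seq n = 0"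
proof (induction n rule: less_induct)
  case (less n)
  then have "U_seq (n - 2 * k) = 0" if "k \<in> {1..n div 2}" for k
    using that by (intro less.IH) (auto elim!: oddE)
  then show ?case using odd_pos[OF less.prems]
    by (subst U_seq.simps) (auto intro!: sum.neutral)
qed

text \<open>The factor is 2 cosh t - 1. Its constant term 1 contributes \<open>U_seq n\<close> and
  its even coefficients 2/(2k)! contribute the sum in the recursion, so everything cancels for n >
  0.\<close>

lemma U_fps_inverse: "(fps_exp 1 + fps_exp (- 1) - 1) * U_fps = 1"
proof (rule fps_ext)
  fix n
  define c where "c = (\<lambda>m. (fps_exp 1 + fps_exp (- 1) - 1 :: rat fps) $ m)"
  have c: "c m = (if m = 0 then 1 else if even m then 2 / fact m else 0)" for m
    by (auto simp: c_def)
  have "((fps_exp 1 + fps_exp (- 1) - 1) * U_fps) $ n = (\<Sum>m = 0..n. c m * U_fps $ (n - m))"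
    unfolding fps_mult_nth c_def ..
  also have "\<dots> = (\<Sum>m \<in> {m \<in> {0..n}. even m}. c m * U_fps $ (n - m))"
    by (rule sum.mono_neutral_right) (auto simp: c)
  also have "\<dots> = (\<Sum>k = 0..n div 2. c (2 * k) * U_fps $ (n - 2 * k))"
    by (rule sum.reindex_bij_witness[of _ "\<lambda>k. 2 * k" "\<lambda>m. m div 2"]) auto
  also have "\<dots> = of_int (U_seq n) / fact n + (\<Sum>k = 1..n div 2. c (2 * k) * U_fps $ (n - 2 * k))"
    by (simp add: sum.atLeast_Suc_atMost c)
  also have "(\<Sum>k = 1..n div 2. c (2 * k) * U_fps $ (n - 2 * k))
      = (\<Sum>k = 1..n div 2. 2 * of_int (int (n choose (2 * k)) * U_seq (n - 2 * k)) / fact n)"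
    by (intro sum.cong) (auto simp: c binomial_fact)
  also have "\<dots> = of_int (2 * (\<Sum>k = 1..n div 2. int (n choose (2 * k)) * U_seq (n - 2 * k))) / fact n"
    by (simp add: sum_distrib_left sum_divide_distrib mult.assoc)
  also have "of_int (U_seq n) / fact n + \<dots> = (1 :: rat fps) $ n"
  proof (cases "n = 0")
    case False
    then have "U_seq n + 2 * (\<Sum>k = 1..n div 2. int (n choose (2 * k)) * U_seq (n - 2 * k)) = 0"
      by (subst U_seq.simps) simp
    then show ?thesis using False
      unfolding add_divide_distrib[symmetric] of_int_add[symmetric] by (simp only:) simp
  qed (simp add: U_seq_0)
  finally show "((fps_exp 1 + fps_exp (- 1) - 1) * U_fps) $ n = (1 :: rat fps) $ n" .
qed

text \<open>The Appell polynomials of \<open>U\<close>, with exponential generating function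
  \<open>e\<^sup>x\<^sup>t / (e\<^sup>t + e\<^sup>-\<^sup>t - 1)\<close>.\<close>

definition G :: "nat \<Rightarrow> rat \<Rightarrow> rat" where
  "G n x = fact n * (fps_exp x * U_fps) $ n"

lemma G_sum: "G n x = (\<Sum>i = 0..n. of_int (int (n choose i) * U_seq (n - i)) * x ^ i)"
  unfolding G_def fps_mult_nth sum_distrib_left
  by (intro sum.cong) (auto simp: binomial_fact)

text \<open>Multiplying the generating function by its denominator e^t + e^(-t) - 1 shifts x by 1,
  -1 and 0 and leaves e^(xt).\<close>

lemma G_recurrence: "G n (x + 1) + G n (x - 1) - G n x = x ^ n"
proof -
  have "fps_exp (x + 1) * U_fps + fps_exp (x - 1) * U_fps - fps_exp x * U_fps
      = fps_exp x * ((fps_exp 1 + fps_exp (- 1) - 1) * U_fps)"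
    using fps_exp_add_mult[of x 1] fps_exp_add_mult[of x "- 1"] by (simp add: algebra_simps)
  also have "\<dots> = fps_exp x" by (simp add: U_fps_inverse)
  finally have "(fps_exp (x + 1) * U_fps + fps_exp (x - 1) * U_fps - fps_exp x * U_fps) $ n
      = fps_exp x $ n" by (rule arg_cong)
  then show ?thesis by (simp add: G_def field_simps)
qed

lemma G_0: "G n 0 = of_int (U_seq n)"
  by (simp add: G_def)

lemma G_uminus:
  assumes "even n"
  shows "G n (- x) = G n x"
  unfolding G_sum
proof (rule sum.cong)
  fix i assume "i \<in> {0..n}"
  then have "odd (n - i)" if "odd i" using that assms by auto
  then show "of_int (int (n choose i) * U_seq (n - i)) * (- x) ^ i
      = of_int (int (n choose i) * U_seq (n - i)) * x ^ i"
    by (cases "even i") (simp_all add: U_seq_odd)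
qed simp

text \<open>The recurrence at 0 reads G(1) + G(-1) - U_n = 0, and G is even for even n.\<close>

lemma G_1:
  assumes "even n" "n > 0"
  shows "G n 1 = of_int (U_seq n) / 2"
  using G_recurrence[of n 0] G_uminus[OF assms(1), of 1] assms(2)
  by (simp add: G_0 power_0_left)

text \<open>Operator form of (y^2 - y + 1)(y + 1) = y^3 + 1: the recurrences centred at x + 1 and x
  + 2 are added and the inner values cancel.\<close>

lemma G_add_3: "G n (x + 3) + G n x = (x + 1) ^ n + (x + 2) ^ n"
  using G_recurrence[of n "x + 1"] G_recurrence[of n "x + 2"] by (simp add: algebra_simps)

lemma alternating_sum_G:
  "(\<Sum>j < N. (- 1) ^ j * ((x + 3 * of_nat j + 1) ^ n + (x + 3 * of_nat j + 2) ^ n))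
    = G n x - (- 1) ^ N * G n (x + 3 * of_nat N)"
proof (induction N)
  case (Suc N)
  have eq: "x + 3 * of_nat (Suc N) = x + 3 * of_nat N + 3" by simp
  have "(- 1) ^ N * ((x + 3 * of_nat N + 1) ^ n + (x + 3 * of_nat N + 2) ^ n)
      = (- 1) ^ N * G n (x + 3 * of_nat N + 3) + (- 1) ^ N * G n (x + 3 * of_nat N)"
    by (simp only: G_add_3[symmetric] distrib_left)
  then show ?case
    unfolding sum.lessThan_Suc Suc.IH eq by simp
qed simp

text \<open>Subtracting all terms gives the even ones the wrong sign; adding them twice corrects
  it.\<close>

lemma alternating_sum_eq:
  fixes f :: "nat \<Rightarrow> rat"
  shows "(\<Sum>l = 1..a. (- 1) ^ l * f l) = 2 * (\<Sum>l = 1..a div 2. f (2 * l)) - (\<Sum>l = 1..a. f l)"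
proof (induction a)
  case (Suc a)
  then show ?case by (cases "even a") (auto elim!: evenE oddE)
qed simp

section \<open>Arithmetic in the localization of the integers at p\<close>

locale prime_gt_3 =
  fixes p :: nat
  assumes prime_p: "prime p" and p_gt_3: "p > 3"
begin

text \<open>The ideal \<open>p\<^sup>m \<int>\<^sub>(\<^sub>p\<^sub>)\<close> of the rationals with denominators prime to \<open>p\<close>.\<close>

definition R :: "nat \<Rightarrow> rat set" where
  "R m = {of_nat p ^ m * of_int a / of_int b | a b. \<not> int p dvd b}"

lemma prime_int_p: "prime (int p)"
  using prime_p by simp

lemma of_nat_p_neq_0 [simp]: "(of_nat p :: rat) \<noteq> 0"
  using p_gt_3 by simp

lemma RI: "\<not> int p dvd b \<Longrightarrow> x = of_nat p ^ m * of_int a / of_int b \<Longrightarrow> x \<in> R m"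
  unfolding R_def by blast

lemma RE:
  assumes "x \<in> R m"
  obtains a b where "\<not> int p dvd b" "b \<noteq> 0" "x = of_nat p ^ m * of_int a / of_int b"
  using assms unfolding R_def by fastforce

lemma not_p_dvd_1: "\<not> int p dvd 1"
  using prime_int_p not_prime_unit by blast

lemma R_of_int: "of_int a \<in> R 0"
  by (rule RI[of 1 _ _ a]) (use not_p_dvd_1 in auto)

lemma R_of_nat [simp]: "of_nat a \<in> R 0"
  using R_of_int[of "int a"] by simp

lemma R_numeral [simp]: "numeral a \<in> R 0"
  using R_of_nat[of "numeral a"] by simp

lemma R_0 [simp]: "0 \<in> R m"
  by (rule RI[of 1 _ _ 0]) (use not_p_dvd_1 in auto)

lemma R_1 [simp]: "1 \<in> R 0"
  using R_of_nat[of 1] by simp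

lemma R_add:
  assumes "x \<in> R m" "y \<in> R m"
  shows "x + y \<in> R m"
proof -
  obtain a b where x: "\<not> int p dvd b" "b \<noteq> 0" "x = of_nat p ^ m * of_int a / of_int b"
    using assms(1) by (rule RE)
  obtain c d where y: "\<not> int p dvd d" "d \<noteq> 0" "y = of_nat p ^ m * of_int c / of_int d"
    using assms(2) by (rule RE)
  show ?thesis
    by (rule RI[of "b * d" _ _ "a * d + b * c"])
      (use x y prime_dvd_mult_iff[OF prime_int_p] in \<open>auto simp: field_simps\<close>)
qed

lemma R_mult:
  assumes "x \<in> R m" "y \<in> R n"
  shows "x * y \<in> R (m + n)"
proof -
  obtain a b where x: "\<not> int p dvd b" "b \<noteq> 0" "x = of_nat p ^ m * of_int a / of_int b"
    using assms(1) by (rule RE)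
  obtain c d where y: "\<not> int p dvd d" "d \<noteq> 0" "y = of_nat p ^ n * of_int c / of_int d"
    using assms(2) by (rule RE)
  show ?thesis
    by (rule RI[of "b * d" _ _ "a * c"])
      (use x y prime_dvd_mult_iff[OF prime_int_p] in \<open>auto simp: field_simps power_add\<close>)
qed

lemma R_mult_left: "x \<in> R 0 \<Longrightarrow> y \<in> R m \<Longrightarrow> x * y \<in> R m"
  using R_mult[of x 0 y m] by simp

lemma R_mult_right: "x \<in> R m \<Longrightarrow> y \<in> R 0 \<Longrightarrow> x * y \<in> R m"
  using R_mult[of x m y 0] by simp

lemma R_uminus: "x \<in> R m \<Longrightarrow> - x \<in> R m"
  using R_mult_left[OF R_of_int[of "-1"], of x] by simp

lemma R_diff: "x \<in> R m \<Longrightarrow> y \<in> R m \<Longrightarrow> x - y \<in> R m"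
  using R_add[of x m "- y"] R_uminus[of y] by simp

lemma R_sum: "(\<And>i. i \<in> A \<Longrightarrow> f i \<in> R m) \<Longrightarrow> sum f A \<in> R m"
  by (induction A rule: infinite_finite_induct) (auto intro: R_add)

lemma R_prod: "(\<And>i. i \<in> A \<Longrightarrow> f i \<in> R 0) \<Longrightarrow> prod f A \<in> R 0"
  by (induction A rule: infinite_finite_induct) (auto intro: R_mult_left)

lemma R_power: "x \<in> R 0 \<Longrightarrow> x ^ n \<in> R 0"
  by (induction n) (auto intro: R_mult_left)

text \<open>Multiplication by p is exactly one step of the filtration: a claim modulo p^2 about a
  multiple of p becomes a claim modulo p about the cofactor.\<close>

lemma R_Suc_iff [simp]: "of_nat p * x \<in> R (Suc m) \<longleftrightarrow> x \<in> R m"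
  unfolding R_def using p_gt_3 by (auto simp: mult.assoc simp flip: times_divide_eq_right)

lemma R_p [simp]: "of_nat p \<in> R (Suc 0)"
  using R_Suc_iff[of 1 0] by simp

lemma R_Suc_subset: "x \<in> R (Suc m) \<Longrightarrow> x \<in> R m"
proof -
  assume "x \<in> R (Suc m)"
  then obtain a b where x: "\<not> int p dvd b" "b \<noteq> 0" "x = of_nat p ^ Suc m * of_int a / of_int b"
    by (rule RE)
  show ?thesis
    by (rule RI[of b _ _ "int p * a"]) (use x in auto)
qed

text \<open>In a local ring the elements outside the maximal ideal are units: here the numerator is
  prime to p and can serve as a denominator.\<close>

lemma R_inverse:
  assumes "x \<in> R 0" "x \<notin> R (Suc 0)"
  shows "x \<noteq> 0" "1 / x \<in> R 0"
proof -
  obtain a b where x: "\<not> int p dvd b" "b \<noteq> 0" "x = of_nat p ^ 0 * of_int a / of_int b"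
    using assms(1) by (rule RE)
  have "\<not> int p dvd a"
  proof
    assume "int p dvd a"
    then obtain c where "a = int p * c" by blast
    then have "x \<in> R (Suc 0)"
      by (intro RI[of b _ _ c]) (use x in auto)
    with assms show False by simp
  qed
  then show "x \<noteq> 0" "1 / x \<in> R 0"
    using x by (auto intro: RI[of a _ _ b])
qed

lemma of_int_R_1_iff: "of_int a \<in> R (Suc 0) \<longleftrightarrow> int p dvd a"
proof
  assume "of_int a \<in> R (Suc 0)"
  then obtain c b where x: "\<not> int p dvd b" "b \<noteq> 0" "of_int a = of_nat p ^ Suc 0 * of_int c / (of_int b :: rat)"
    by (rule RE)
  then have "of_int (a * b) = (of_int (int p * c) :: rat)"
    by (simp add: field_simps)
  then have "a * b = int p * c"
    unfolding of_int_eq_iff .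
  then have "int p dvd a * b" by simp
  with x show "int p dvd a"
    using prime_dvd_mult_iff[OF prime_int_p] by blast
next
  assume "int p dvd a"
  then obtain c where "a = int p * c" by blast
  then show "of_int a \<in> R (Suc 0)"
    by (intro RI[of 1 _ _ c]) (use not_p_dvd_1 in auto)
qed

lemma of_nat_R_1_iff: "of_nat a \<in> R (Suc 0) \<longleftrightarrow> p dvd a"
  using of_int_R_1_iff[of "int a"] by simp

lemma R_divide_of_nat:
  assumes "x \<in> R m" "\<not> p dvd k"
  shows "x / of_nat k \<in> R m"
  using R_mult_right[OF assms(1), of "1 / of_nat k"] R_inverse(2)[of "of_nat k"] assms(2)
  by (simp add: of_nat_R_1_iff)

lemma not_p_dvd_2_3: "\<not> p dvd 2" "\<not> p dvd 3"
  using p_gt_3 by (auto dest: dvd_imp_le)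

lemma not_p_dvd_2_power_3_power: "\<not> p dvd 2 ^ i * 3 ^ j"
  using not_p_dvd_2_3 prime_p by (auto simp: prime_dvd_mult_iff dest: prime_dvd_power)

text \<open>Links the definition through lowest terms with the ideals \<open>R\<close>. If x also
  equals c/d with d prime to p, the reduced denominator divides d.\<close>

lemma denom_prime_to_iff: "denom_prime_to p x \<longleftrightarrow> x \<in> R 0"
proof -
  obtain a b where ab: "quotient_of x = (a, b)" by fastforce
  then have x: "x = of_int a / of_int b" "b > 0" "coprime a b"
    by (auto simp: quotient_of_div quotient_of_denom_pos quotient_of_coprime)
  have iff: "denom_prime_to p x \<longleftrightarrow> \<not> int p dvd b"
    using ab prime_int_p unfolding denom_prime_to_def
    by (metis coprime_absorb_right coprime_commute not_prime_unit prime_imp_coprime snd_conv)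
  show ?thesis
  proof
    assume "denom_prime_to p x"
    then show "x \<in> R 0" using iff x by (auto intro: RI[of b _ _ a])
  next
    assume "x \<in> R 0"
    then obtain c d where y: "\<not> int p dvd d" "d \<noteq> 0" "x = of_nat p ^ 0 * of_int c / of_int d"
      by (rule RE)
    then have "of_int (a * d) = (of_int (c * b) :: rat)"
      using x by (simp add: field_simps)
    then have "a * d = c * b"
      unfolding of_int_eq_iff .
    then have "b dvd a * d" by simp
    then have "b dvd d" using \<open>coprime a b\<close> by (simp add: coprime_commute coprime_dvd_mult_right_iff)
    with y(1) iff show "denom_prime_to p x" using dvd_trans by blast
  qed
qed

lemma R_cong_mult:
  assumes "x - x' \<in> R m" "y - y' \<in> R m" "x \<in> R 0" "y' \<in> R 0"
  shows "x * y - x' * y' \<in> R m"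
proof -
  have "x * y - x' * y' = x * (y - y') + (x - x') * y'" by (simp add: algebra_simps)
  also have "\<dots> \<in> R m" by (intro R_add R_mult_left[of x] R_mult_right[of "x - x'"] assms)
  finally show ?thesis .
qed

lemma R_cong_sum:
  "(\<And>i. i \<in> A \<Longrightarrow> f i - g i \<in> R m) \<Longrightarrow> sum f A - sum g A \<in> R m"
  unfolding sum_subtractf[symmetric] by (rule R_sum)

lemma R_cong_prod:
  assumes "\<And>i. i \<in> A \<Longrightarrow> f i - g i \<in> R m" "\<And>i. i \<in> A \<Longrightarrow> f i \<in> R 0" "\<And>i. i \<in> A \<Longrightarrow> g i \<in> R 0"
  shows "prod f A - prod g A \<in> R m"
  using assms
  by (induction A rule: infinite_finite_induct) (simp_all add: R_cong_mult R_prod)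

lemma R_eqI: "x \<in> R m \<Longrightarrow> y = x \<Longrightarrow> y \<in> R m"
  by simp

lemma R_cong_sym: "x - y \<in> R m \<Longrightarrow> y - x \<in> R m"
  using R_uminus[of "x - y"] by simp

section \<open>Reflection and parity splitting for the harmonic sums\<close>

definition H :: "nat \<Rightarrow> rat" where "H N = (\<Sum>k = 1..N. 1 / of_nat k)"

definition X :: "nat \<Rightarrow> rat" where "X N = (\<Sum>k = 1..N. 1 / of_nat k ^ 2)"

lemma not_p_dvd: "0 < k \<Longrightarrow> k < p \<Longrightarrow> \<not> p dvd k"
  by (auto dest: dvd_imp_le)

lemma R_inverse_of_nat:
  assumes "0 < k" "k < p"
  shows "1 / of_nat k \<in> R 0"
  using R_divide_of_nat[OF R_1 not_p_dvd[OF assms]] .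

text \<open>These are the first two terms of the expansion of 1/(p - k) in powers of p/k; the
  remainder is exactly p^2/(k^2 (p - k)).\<close>

lemma reflect_inverse:
  assumes "0 < k" "k < p"
  shows "1 / of_nat (p - k) - (- 1 / of_nat k - of_nat p / of_nat k ^ 2) \<in> R 2"
proof -
  have "1 / of_nat (p - k) - (- 1 / of_nat k - of_nat p / of_nat k ^ 2)
      = of_nat p * (of_nat p * (1 / of_nat k * (1 / of_nat k) * (1 / of_nat (p - k))) :: rat)"
  proof -
    define q where "q = p - k"
    then have "p = k + q" "q \<noteq> 0" using assms by auto
    then show ?thesis using assms unfolding q_def[symmetric]
      by (simp add: field_simps power2_eq_square)
  qed
  then show ?thesis using assms
    by (simp only: R_Suc_iff numeral_2_eq_2)
      (intro R_mult_left R_inverse_of_nat, auto)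
qed

lemma reflect_inverse_square:
  assumes "0 < k" "k < p"
  shows "1 / of_nat (p - k) ^ 2 - 1 / of_nat k ^ 2 \<in> R 1"
proof -
  have "1 / of_nat (p - k) ^ 2 - 1 / of_nat k ^ 2
      = of_nat p * ((of_nat k - of_nat (p - k)) * (1 / of_nat k * (1 / of_nat k)
        * (1 / of_nat (p - k) * (1 / of_nat (p - k)))) :: rat)"
  proof -
    define q where "q = p - k"
    then have "p = k + q" "q \<noteq> 0" using assms by auto
    then show ?thesis using assms unfolding q_def[symmetric]
      by (simp add: field_simps power2_eq_square)
  qed
  then show ?thesis using assms
    by (simp only: R_Suc_iff One_nat_def)
      (intro R_mult_left R_inverse_of_nat R_diff R_of_nat, auto)
qed

lemma sum_reflect_tail:
  assumes "N < p"
  shows "(\<Sum>k = 1..p - 1. f k) = (\<Sum>k = 1..p - 1 - N. f k) + (\<Sum>k = 1..N. f (p - k) :: rat)"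
proof -
  have "(\<Sum>k = 1..N. f (p - k)) = (\<Sum>k = p - N..p - 1. f k)"
    by (rule sum.reindex_bij_witness[of _ "\<lambda>k. p - k" "\<lambda>k. p - k"]) (use assms in auto)
  moreover have "{1..p - 1} = {1..p - 1 - N} \<union> {p - N..p - 1}" using assms p_gt_3 by auto
  ultimately show ?thesis
    using assms by (auto simp: sum.union_disjoint)
qed

text \<open>As p is odd, an odd k is p - 2l with l = (p - k)/2, and k \<le> K means l > (p - 1 -
  K)/2. The odd terms thus become reflections of even numbers.\<close>

lemma sum_even_odd_reflect:
  assumes "K < p"
  shows "(\<Sum>k = 1..K. f k) = (\<Sum>l = 1..K div 2. f (2 * l))
    + (\<Sum>l = Suc ((p - 1 - K) div 2)..(p - 1) div 2. f (p - 2 * l) :: rat)"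
proof -
  have "odd p" using prime_p p_gt_3 prime_odd_nat by auto
  have "(\<Sum>l = 1..K div 2. f (2 * l)) = sum f {k \<in> {1..K}. even k}"
    by (rule sum.reindex_bij_witness[of _ "\<lambda>k. k div 2" "\<lambda>l. 2 * l"]) auto
  moreover have "(\<Sum>l = Suc ((p - 1 - K) div 2)..(p - 1) div 2. f (p - 2 * l))
      = sum f {k \<in> {1..K}. odd k}"
  proof (rule sum.reindex_bij_witness[of _ "\<lambda>k. (p - k) div 2" "\<lambda>l. p - 2 * l"])
    fix k assume k: "k \<in> {k \<in> {1..K}. odd k}"
    obtain h b where hb: "p = 2 * h + 1" "k = 2 * b + 1"
      using k \<open>odd p\<close> by (auto elim!: oddE)
    have "b < h" "p - 1 - K < (h - b) * 2" using k hb assms by auto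
    then have "(p - 1 - K) div 2 < h - b" by (intro less_mult_imp_div_less)
    moreover have "p - k = 2 * (h - b)" by (simp add: hb)
    ultimately show "(p - k) div 2 \<in> {Suc ((p - 1 - K) div 2)..(p - 1) div 2}"
      by (simp add: hb(1))
  qed (use \<open>odd p\<close> assms p_gt_3 in \<open>auto elim!: oddE\<close>)
  moreover have "sum f {1..K} = sum f ({k \<in> {1..K}. even k} \<union> {k \<in> {1..K}. odd k})"
    by (rule arg_cong[where f = "sum f"]) auto
  then have "sum f {1..K} = sum f {k \<in> {1..K}. even k} + sum f {k \<in> {1..K}. odd k}"
    by (simp add: sum.union_disjoint disjoint_iff)
  ultimately show ?thesis by simp
qed

lemma X_reflect:
  assumes "N < p"
  shows "X (p - 1) - (X (p - 1 - N) + X N) \<in> R 1"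
proof -
  have "X (p - 1) - (X (p - 1 - N) + X N) = (\<Sum>k = 1..N. 1 / of_nat (p - k) ^ 2) - (\<Sum>k = 1..N. 1 / of_nat k ^ 2)"
    unfolding X_def using sum_reflect_tail[OF assms, of "\<lambda>k. 1 / of_nat k ^ 2"] by simp
  also have "\<dots> \<in> R 1"
    by (intro R_cong_sum reflect_inverse_square) (use assms in auto)
  finally show ?thesis .
qed

lemma sum_interval_diff:
  assumes "a \<le> b"
  shows "(\<Sum>k = Suc a..b. f k) = (\<Sum>k = 1..b. f k) - (\<Sum>k = 1..a. f k :: rat)"
proof -
  have "{1..b} = {1..a} \<union> {Suc a..b}" using assms by auto
  then show ?thesis by (simp add: sum.union_disjoint)
qed

lemma X_even_odd:
  assumes "K < p"
  shows "X K - (X (K div 2) + X ((p - 1) div 2) - X ((p - 1 - K) div 2)) / 4 \<in> R 1"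
proof -
  let ?S = "{Suc ((p - 1 - K) div 2)..(p - 1) div 2}"
  have X: "X ((p - 1) div 2) - X ((p - 1 - K) div 2) = (\<Sum>l \<in> ?S. 1 / of_nat l ^ 2)"
    unfolding X_def using assms by (intro sum_interval_diff[symmetric] div_le_mono) auto
  have "X K = X (K div 2) / 4 + (\<Sum>l \<in> ?S. 1 / of_nat (p - 2 * l) ^ 2)"
    unfolding X_def using sum_even_odd_reflect[OF assms, of "\<lambda>k. 1 / of_nat k ^ 2"]
    by (simp add: power_mult_distrib sum_divide_distrib mult.commute)
  then have "X K - (X (K div 2) + X ((p - 1) div 2) - X ((p - 1 - K) div 2)) / 4
      = (\<Sum>l \<in> ?S. 1 / of_nat (p - 2 * l) ^ 2) - (X ((p - 1) div 2) - X ((p - 1 - K) div 2)) / 4"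
    by (simp add: field_simps)
  also have "\<dots> = (\<Sum>l \<in> ?S. 1 / of_nat (p - 2 * l) ^ 2) - (\<Sum>l \<in> ?S. 1 / of_nat (2 * l) ^ 2)"
    unfolding X by (simp add: power_mult_distrib sum_divide_distrib mult.commute)
  also have "\<dots> \<in> R 1"
    by (intro R_cong_sum reflect_inverse_square) auto
  finally show ?thesis .
qed

text \<open>For the odd terms \<open>reflect_inverse\<close> at 2l gives -1/(2l) - p/(4 l^2); the
  second summand is the source of the correction by X.\<close>

lemma H_even_odd:
  assumes "K < p"
  shows "H K - (H (K div 2) - H ((p - 1) div 2) + H ((p - 1 - K) div 2)) / 2
    + of_nat p * (X ((p - 1) div 2) - X ((p - 1 - K) div 2)) / 4 \<in> R 2"
proof -
  let ?S = "{Suc ((p - 1 - K) div 2)..(p - 1) div 2}"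
  have X: "X ((p - 1) div 2) - X ((p - 1 - K) div 2) = (\<Sum>l \<in> ?S. 1 / of_nat l ^ 2)"
    unfolding X_def using assms by (intro sum_interval_diff[symmetric] div_le_mono) auto
  have H: "H ((p - 1) div 2) - H ((p - 1 - K) div 2) = (\<Sum>l \<in> ?S. 1 / of_nat l)"
    unfolding H_def using assms by (intro sum_interval_diff[symmetric] div_le_mono) auto
  have "H K = H (K div 2) / 2 + (\<Sum>l \<in> ?S. 1 / of_nat (p - 2 * l))"
    unfolding H_def using sum_even_odd_reflect[OF assms, of "\<lambda>k. 1 / of_nat k"]
    by (simp add: sum_divide_distrib field_simps)
  then have "H K - (H (K div 2) - H ((p - 1) div 2) + H ((p - 1 - K) div 2)) / 2
      + of_nat p * (X ((p - 1) div 2) - X ((p - 1 - K) div 2)) / 4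
      = (\<Sum>l \<in> ?S. 1 / of_nat (p - 2 * l)) + (H ((p - 1) div 2) - H ((p - 1 - K) div 2)) / 2
       + of_nat p * (X ((p - 1) div 2) - X ((p - 1 - K) div 2)) / 4"
    by (simp add: field_simps)
  also have "\<dots> = (\<Sum>l \<in> ?S. 1 / of_nat (p - 2 * l))
      - (\<Sum>l \<in> ?S. - 1 / of_nat (2 * l) - of_nat p / of_nat (2 * l) ^ 2)"
    unfolding X H
    by (simp add: sum_divide_distrib sum_distrib_left power_mult_distrib sum_subtractf sum_negf mult.commute)
  also have "\<dots> \<in> R 2"
    by (intro R_cong_sum reflect_inverse) auto
  finally show ?thesis .
qed

text \<open>With h = (p - 1)/2, reflection at h gives X(p - 1) = 2 X(h) modulo p, while parity
  splitting at p - 1 gives X(p - 1) = X(h)/2. Hence 3 X(h) vanishes, and 3 is invertible.\<close>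

lemma X_p_minus_1: "X (p - 1) \<in> R 1"
  and X_half: "X ((p - 1) div 2) \<in> R 1"
proof -
  have "odd p" using prime_p p_gt_3 prime_odd_nat by auto
  then have eq: "p - 1 - (p - 1) div 2 = (p - 1) div 2" by (auto elim!: oddE)
  have 1: "X (p - 1) - (X ((p - 1) div 2) + X ((p - 1) div 2)) \<in> R 1"
    using X_reflect[of "(p - 1) div 2"] p_gt_3 unfolding eq by auto
  have 2: "X (p - 1) - (X ((p - 1) div 2) + X ((p - 1) div 2)) / 4 \<in> R 1"
    using X_even_odd[of "p - 1"] p_gt_3 by (simp add: X_def)
  have "3 * X ((p - 1) div 2) \<in> R 1"
    using R_mult_left[of 2, OF _ R_diff[OF 2 1]] by (simp add: field_simps)
  then show half: "X ((p - 1) div 2) \<in> R 1"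
    using R_divide_of_nat[OF _ not_p_dvd_2_3(2), of "3 * X ((p - 1) div 2)"] by simp
  show "X (p - 1) \<in> R 1" using R_add[OF 1 R_add[OF half half]] by simp
qed

lemma X_reflect': "N < p \<Longrightarrow> X (p - 1 - N) + X N \<in> R 1"
  using R_diff[OF X_p_minus_1 X_reflect[of N]] by simp

lemma H_reflect_aux:
  assumes "N < p"
  shows "H (p - 1) - (H (p - 1 - N) - H N - of_nat p * X N) \<in> R 2"
proof -
  have "H (p - 1) = H (p - 1 - N) + (\<Sum>k = 1..N. 1 / of_nat (p - k))"
    unfolding H_def using sum_reflect_tail[OF assms, of "\<lambda>k. 1 / of_nat k"] by simp
  then have "H (p - 1) - (H (p - 1 - N) - H N - of_nat p * X N)
      = (\<Sum>k = 1..N. 1 / of_nat (p - k)) - (\<Sum>k = 1..N. - 1 / of_nat k - of_nat p / of_nat k ^ 2)"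
    unfolding H_def X_def by (simp add: sum_subtractf sum_negf sum_distrib_left)
  also have "\<dots> \<in> R 2"
    by (intro R_cong_sum reflect_inverse) (use assms in auto)
  finally show ?thesis .
qed

text \<open>Wolstenholme's theorem: reflecting the whole sum gives 2 H(p - 1) + p X(p - 1) = 0
  modulo p^2, and p X(p - 1) vanishes by \<open>X_p_minus_1\<close>.\<close>

lemma H_p_minus_1: "H (p - 1) \<in> R 2"
proof -
  have "2 * H (p - 1) + of_nat p * X (p - 1) \<in> R 2"
    using H_reflect_aux[of "p - 1"] p_gt_3 by (simp add: H_def)
  moreover have "of_nat p * X (p - 1) \<in> R 2"
    using X_p_minus_1 by (simp add: numeral_2_eq_2)
  ultimately have "2 * H (p - 1) \<in> R 2"
    using R_diff[of "2 * H (p - 1) + of_nat p * X (p - 1)" 2 "of_nat p * X (p - 1)"] by simp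
  then show ?thesis
    using R_divide_of_nat[OF _ not_p_dvd_2_3(1), of "2 * H (p - 1)"] by simp
qed

lemma H_reflect: "N < p \<Longrightarrow> H (p - 1 - N) - (H N + of_nat p * X N) \<in> R 2"
  using R_diff[OF H_p_minus_1 H_reflect_aux[of N]] by (simp add: algebra_simps)

section \<open>Relations between the sums at p/6, p/3 and p/2\<close>

text \<open>Collects the floors for both residues. The equation for
  \<open>(p - 1 - p div 3) div 2\<close> makes the parity splitting at p/3 return to p/3, so it
  involves only p/6, p/3 and p/2.\<close>

lemma p_mod_6:
  obtains (1) m where "p = 6 * m + 1" "m > 0" "p div 6 = m" "p div 3 = 2 * m"
      "(p - 1 - p div 3) div 2 = p div 3" "p mod 3 = 1"
    | (5) m where "p = 6 * m + 5" "p div 6 = m" "p div 3 = 2 * m + 1"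
      "(p - 1 - p div 3) div 2 = p div 3" "p mod 3 = 2"
proof -
  have mod_3: "p mod 3 = p mod 6 mod 3" by (simp add: mod_mod_cancel)
  define m where "m = p div 6"
  have "odd p" using prime_p p_gt_3 prime_odd_nat by auto
  moreover have "\<not> 3 dvd p"
    using prime_p p_gt_3 primes_dvd_imp_eq[of 3 p] by auto
  ultimately have "p mod 6 = 1 \<or> p mod 6 = 5" by presburger
  moreover have "p = 6 * m + p mod 6" by (simp add: m_def)
  ultimately consider "p = 6 * m + 1" | "p = 6 * m + 5" by auto
  then show thesis
  proof cases
    case 1
    have div_3: "p div 3 = 2 * m" by (simp add: 1)
    have "m > 0" using p_gt_3 by (simp add: 1)
    moreover have "p div 6 = m" "p mod 3 = 1" unfolding mod_3 by (simp_all add: 1)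
    moreover have "(p - 1 - p div 3) div 2 = p div 3" unfolding div_3 by (simp add: 1)
    ultimately show thesis using that(1) 1 div_3 by blast
  next
    case 2
    have div_3: "p div 3 = 2 * m + 1" by (simp add: 2)
    have "p div 6 = m" "p mod 3 = 2" unfolding mod_3 by (simp_all add: 2)
    moreover have "(p - 1 - p div 3) div 2 = p div 3" unfolding div_3 by (simp add: 2)
    ultimately show thesis using that(2) 2 div_3 by blast
  qed
qed

text \<open>Parity splitting at a = p div 3, without the vanishing X at p/2, reads 4 X(a) = X(p div
  6) - X(a) modulo p.\<close>

lemma X_sixth: "X (p div 6) - 5 * X (p div 3) \<in> R 1"
proof -
  have "p div 3 div 2 = p div 6" by (simp add: div_mult2_eq[symmetric])
  moreover have "(p - 1 - p div 3) div 2 = p div 3" by (rule p_mod_6)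
  ultimately have "X (p div 3) - (X (p div 6) + X ((p - 1) div 2) - X (p div 3)) / 4 \<in> R 1"
    using X_even_odd[of "p div 3"] p_gt_3 by simp
  from R_add[OF R_mult_left[OF R_of_int[of "-4"] this] R_uminus[OF X_half]] show ?thesis
    by (rule R_eqI) (simp add: field_simps)
qed

lemma H_sixth:
  "H (p div 6) - (H (p div 3) + H ((p - 1) div 2) - of_nat p * X (p div 3) / 2) \<in> R 2"
proof -
  have "p div 3 div 2 = p div 6" by (simp add: div_mult2_eq[symmetric])
  moreover have "(p - 1 - p div 3) div 2 = p div 3" by (rule p_mod_6)
  ultimately have *: "H (p div 3) - (H (p div 6) - H ((p - 1) div 2) + H (p div 3)) / 2
      + of_nat p * (X ((p - 1) div 2) - X (p div 3)) / 4 \<in> R 2"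
    using H_even_odd[of "p div 3"] p_gt_3 by simp
  have "of_nat p * X ((p - 1) div 2) / of_nat 2 \<in> R 2"
    using X_half by (intro R_divide_of_nat not_p_dvd_2_3) (simp add: numeral_2_eq_2)
  from R_add[OF R_mult_left[OF R_of_int[of "-2"] *] this] show ?thesis
    by (rule R_eqI) (simp add: field_simps)
qed

section \<open>The sum S(a) modulo p^2\<close>

lemma R_p_power_mult: "x \<in> R 0 \<Longrightarrow> of_nat p ^ m * x \<in> R m"
  by (induction m) (auto simp: mult.assoc)

lemma R_fact: "n < p \<Longrightarrow> x \<in> R m \<Longrightarrow> x / fact n \<in> R m"
  using R_divide_of_nat[of x m "fact n"] prime_p by (simp add: prime_dvd_fact_iff)

lemma R_gbinomial: "a \<in> R 0 \<Longrightarrow> k < p \<Longrightarrow> a gchoose k \<in> R 0"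
  unfolding gbinomial_prod_rev by (intro R_fact R_prod R_diff R_of_nat)

lemma R_cong_gbinomial:
  assumes "a - b \<in> R m" "a \<in> R 0" "b \<in> R 0" "k < p"
  shows "(a gchoose k) - (b gchoose k) \<in> R m"
  unfolding gbinomial_prod_rev diff_divide_distrib[symmetric]
proof (intro R_fact R_cong_prod)
  fix i
  show "a - of_nat i - (b - of_nat i) \<in> R m" using assms(1) by simp
qed (intro R_diff R_of_nat assms)+

lemma minus_one_gchoose: "(- 1 :: rat) gchoose k = (- 1) ^ k"
  by (subst gbinomial_minus) (simp add: binomial_gbinomial[symmetric])

definition S :: "rat \<Rightarrow> rat" where
  "S a = (\<Sum>k = 1..p - 1. (- 1) ^ k / of_nat k * (a gchoose k))"

lemma even_p_minus_1: "even (p - 1)"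
  using prime_p p_gt_3 prime_odd_nat[of p] by simp

text \<open>By Pascal and absorption the difference of the k-th terms is (-1)^k (a gchoose k)/a. The
  alternating partial sum of row a is \<open>a - 1 gchoose (p - 1)\<close>, as p - 1 is even; the
  term k = 0 accounts for the -1.\<close>

lemma S_diff:
  assumes "a \<noteq> 0"
  shows "S a - S (a - 1) = ((a - 1 gchoose (p - 1)) - 1) / a"
proof -
  have "(- 1) ^ k / of_nat k * (a gchoose k) - (- 1) ^ k / of_nat k * (a - 1 gchoose k)
      = (a gchoose k) * (- 1) ^ k / a" if k: "k \<in> {1..p - 1}" for k
  proof -
    obtain l where l: "k = Suc l" using k by (cases k) auto
    have "(a gchoose Suc l) = (a - 1 gchoose l) + (a - 1 gchoose Suc l)"
      using gbinomial_Suc_Suc[of "a - 1" l] by simp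
    moreover have "of_nat (Suc l) * (a gchoose Suc l) = a * (a - 1 gchoose l)"
      by (rule gbinomial_absorption)
    then have eq: "(a gchoose Suc l) / a = (a - 1 gchoose l) / of_nat (Suc l)"
      using assms by (simp add: field_simps del: of_nat_Suc)
    ultimately have "(- 1) ^ k / of_nat k * (a gchoose k) - (- 1) ^ k / of_nat k * (a - 1 gchoose k)
        = (- 1) ^ k * ((a - 1 gchoose l) / of_nat (Suc l))"
      unfolding l by (simp add: algebra_simps add_divide_distrib)
    then show ?thesis unfolding eq[symmetric] l by simp
  qed
  then have "S a - S (a - 1) = (\<Sum>k = 1..p - 1. (a gchoose k) * (- 1) ^ k / a)"
    unfolding S_def sum_subtractf[symmetric] by (intro sum.cong) auto
  also have "\<dots> = ((\<Sum>k \<le> p - 1. (a gchoose k) * (- 1) ^ k) - 1) / a"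
    by (simp add: sum.atLeast1_atMost_eq atMost_atLeast0 sum.atLeast_Suc_atMost sum_divide_distrib[symmetric])
  also have "\<dots> = ((a - 1 gchoose (p - 1)) - 1) / a"
    unfolding gbinomial_sum_lower_neg using even_p_minus_1 by simp
  finally show ?thesis .
qed

text \<open>Absorption extracts pt/k from the binomial coefficient and leaves
  \<open>of_nat p * t - 1 gchoose (k - 1)\<close>, which is (-1)^(k-1) modulo p. So the sum is -pt
  X(p - 1), which vanishes modulo p^2.\<close>

lemma S_multiple:
  assumes t: "t \<in> R 0"
  shows "S (of_nat p * t) \<in> R 2"
proof -
  have pt: "of_nat p * t \<in> R 1" using t by simp
  then have pt0: "of_nat p * t \<in> R 0" using R_Suc_subset[of _ 0] by simp
  have "(- 1) ^ k / of_nat k * (of_nat p * t gchoose k) - - (of_nat p * t) * (1 / of_nat k ^ 2) \<in> R 2"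
    if k_in: "k \<in> {1..p - 1}" for k
  proof -
    obtain l where l: "k = Suc l" using k_in by (cases k) auto
    have k: "0 < k" "k < p" "l < p" using k_in p_gt_3 l by auto
    have "of_nat k * (of_nat p * t gchoose k) = of_nat p * t * (of_nat p * t - 1 gchoose l)"
      unfolding l by (rule gbinomial_absorption)
    then have "(of_nat p * t gchoose k) = of_nat p * t * (of_nat p * t - 1 gchoose l) / of_nat k"
      using k by (simp add: field_simps)
    then have "(- 1) ^ k / of_nat k * (of_nat p * t gchoose k) - - (of_nat p * t) * (1 / of_nat k ^ 2)
        = of_nat p * ((- 1) ^ k * t * (1 / of_nat k) * (1 / of_nat k)
            * ((of_nat p * t - 1 gchoose l) - (- 1 gchoose l)))"
      using k unfolding minus_one_gchoose
      by (simp add: l divide_simps power2_eq_square del: of_nat_Suc)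
        (simp add: algebra_simps minus_one_mult_self flip: power_add)
    moreover have "(of_nat p * t - 1 gchoose l) - (- 1 gchoose l) \<in> R 1"
      by (rule R_cong_gbinomial[OF _ R_diff[OF pt0 R_1] R_uminus[OF R_1]]) (use pt k in auto)
    ultimately show ?thesis using k t
      by (simp only: R_Suc_iff numeral_2_eq_2)
        (intro R_mult_left R_power R_uminus R_inverse_of_nat, auto)
  qed
  then have "S (of_nat p * t) - (\<Sum>k = 1..p - 1. - (of_nat p * t) * (1 / of_nat k ^ 2)) \<in> R 2"
    unfolding S_def by (intro R_cong_sum) auto
  moreover have "(\<Sum>k = 1..p - 1. - (of_nat p * t) * (1 / of_nat k ^ 2)) = of_nat p * (- t * X (p - 1))"
    unfolding X_def by (simp add: sum_distrib_left sum_negf mult.assoc)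
  moreover have "of_nat p * (- t * X (p - 1)) \<in> R 2"
    using X_p_minus_1 t unfolding numeral_2_eq_2 R_Suc_iff by (intro R_mult_left R_uminus) auto
  ultimately show ?thesis
    using R_add[of "S (of_nat p * t) - of_nat p * (- t * X (p - 1))" 2 "of_nat p * (- t * X (p - 1))"]
    by simp
qed

lemma R_1_unit:
  assumes "x - (- 1) ^ j \<in> R 1" "x \<in> R 0"
  shows "x \<notin> R (Suc 0)"
proof
  assume "x \<in> R (Suc 0)"
  from R_diff[OF this assms(1)[unfolded One_nat_def]]
  have "of_int ((- 1) ^ j) \<in> R (Suc 0)" by (rule R_eqI) simp
  then have "int p dvd (- 1) ^ j" unfolding of_int_R_1_iff .
  then show False using not_p_dvd_1 by (cases "even j") simp_all
qed

text \<open>With a = j + pt - 1, trinomial revision gives C(a, p-1) u = C(a, j) v, and absorption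
  gives C(a, j) = (pt/j) w. Modulo p, w is 1 while u and v are both (-1)^j; the factor p lifts this
  to p^2.\<close>

lemma gbinomial_p_minus_1:
  assumes t: "t \<in> R 0" and j: "0 < j" "j < p"
  shows "(of_nat j + of_nat p * t - 1 gchoose (p - 1)) - of_nat p * t / of_nat j \<in> R 2"
proof -
  have pt: "of_nat p * t \<in> R 1" using t by simp
  then have pt0: "of_nat p * t \<in> R 0" using R_Suc_subset[of _ 0] by simp
  obtain l where l: "j = Suc l" using j by (cases j) auto
  define a where "a = of_nat j + of_nat p * t - 1"
  define u where "u = (of_nat (p - 1) gchoose j :: rat)"
  define v where "v = (a - of_nat j gchoose (p - 1 - j))"
  define w where "w = (a gchoose l)"
  have a: "a \<in> R 0" unfolding a_def by (intro R_diff R_add pt0) auto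
  have u0: "u \<in> R 0" unfolding u_def by (rule R_gbinomial[OF R_of_nat j(2)])
  have "of_nat (p - 1) - (- 1) \<in> R 1" using p_gt_3 by (simp add: of_nat_diff)
  then have "u - (- 1 gchoose j) \<in> R 1" unfolding u_def
    by (rule R_cong_gbinomial[OF _ R_of_nat R_uminus[OF R_1] j(2)])
  then have u: "u - (- 1) ^ j \<in> R 1" by (simp add: minus_one_gchoose)
  then have u_unit: "u \<noteq> 0" "1 / u \<in> R 0" using R_inverse[OF u0] R_1_unit[OF _ u0] by auto
  have "v - (- 1 gchoose (p - 1 - j)) \<in> R 1" unfolding v_def
    by (rule R_cong_gbinomial[OF _ R_diff[OF a R_of_nat] R_uminus[OF R_1]]) (use j pt in \<open>auto simp: a_def\<close>)
  moreover have "(- 1 :: rat) ^ (p - 1 - j) = (- 1) ^ j"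
    using even_p_minus_1 j by (auto simp: minus_one_power_iff)
  ultimately have v: "v - (- 1) ^ j \<in> R 1" by (simp add: minus_one_gchoose)
  have v0: "v \<in> R 0" unfolding v_def using j by (intro R_gbinomial R_diff a) auto
  have "w - (of_nat l gchoose l) \<in> R 1" unfolding w_def
    by (rule R_cong_gbinomial[OF _ a R_of_nat]) (use j pt in \<open>auto simp: a_def l\<close>)
  then have w: "w - 1 \<in> R 1" by (simp add: binomial_gbinomial[symmetric])
  have "w * v - 1 * (- 1) ^ j \<in> R 1"
    using w v by (rule R_cong_mult) (use j in \<open>auto simp: w_def l intro!: R_gbinomial a R_power R_uminus\<close>)
  then have wv: "w * v - u \<in> R 1" using R_diff[OF _ u, of "w * v - 1 * (- 1) ^ j"] by simp
  have "of_nat j * (a gchoose j) = (a - of_nat l) * w"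
    unfolding w_def l using gbinomial_absorption[of l a] gbinomial_absorb_comp[of a l] by simp
  moreover have "a - of_nat l = of_nat p * t" by (simp add: a_def l)
  ultimately have "(a gchoose j) = of_nat p * t * w / of_nat j"
    using j by (simp add: field_simps)
  moreover have "(a gchoose (p - 1)) * u = (a gchoose j) * v"
    unfolding u_def v_def using j by (intro gbinomial_trinomial_revision) auto
  then have "(a gchoose (p - 1)) = (a gchoose j) * v / u"
    using u_unit(1) by (simp add: field_simps)
  ultimately have "(a gchoose (p - 1)) = of_nat p * t * w / of_nat j * v / u" by simp
  then have "(a gchoose (p - 1)) - of_nat p * t / of_nat j
      = of_nat p * (t * (1 / of_nat j) * (1 / u) * (w * v - u))"
    using u_unit(1) j by (simp add: field_simps)
  also have "\<dots> \<in> R 2"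
    unfolding numeral_2_eq_2 R_Suc_iff using t u_unit(2) wv j
    by (intro R_mult_left R_inverse_of_nat) auto
  finally show ?thesis unfolding a_def .
qed

text \<open>Induction on r from \<open>S_multiple\<close>. With j = r + 1 and x = pt the increment
  (x/j - 1)/(j + x) expands to -1/j + 2x/j^2 modulo p^2.\<close>

lemma S_shift:
  assumes t: "t \<in> R 0"
  shows "r < p \<Longrightarrow> S (of_nat r + of_nat p * t) - (- H r + 2 * of_nat p * t * X r) \<in> R 2"
proof (induction r)
  case 0
  then show ?case using S_multiple[OF t] by (simp add: H_def X_def)
next
  case (Suc r)
  define j where "j = Suc r"
  define x where "x = of_nat p * t"
  define a where "a = of_nat j + x"
  have j: "0 < j" "j < p" using Suc.prems by (auto simp: j_def)
  have x: "x \<in> R 1" using t by (simp add: x_def)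
  then have a0: "a \<in> R 0" unfolding a_def using R_Suc_subset[of x 0] by (intro R_add) auto
  have "a \<notin> R (Suc 0)"
  proof
    assume "a \<in> R (Suc 0)"
    from R_diff[OF this, of x] x have "of_nat j \<in> R (Suc 0)" by (simp add: a_def)
    with not_p_dvd[OF j] show False by (simp add: of_nat_R_1_iff)
  qed
  from R_inverse[OF a0 this] have a: "a \<noteq> 0" "1 / a \<in> R 0" by auto
  define C where "C = (a - 1 gchoose (p - 1))"
  have C: "C - x / of_nat j \<in> R 2"
    using gbinomial_p_minus_1[OF t j] by (simp add: C_def a_def x_def)
  have "S a - S (a - 1) - (- 1 / of_nat j + 2 * x / of_nat j ^ 2)
      = (C - 1) / a - (- 1 / of_nat j + 2 * x / of_nat j ^ 2)"
    unfolding C_def by (simp add: S_diff[OF a(1)])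
  also have "\<dots> = (1 / a) * (C - x / of_nat j)
      + of_nat p ^ 2 * (- 2 * t * t * (1 / of_nat j) * (1 / of_nat j) * (1 / a))"
  proof -
    \<comment> \<open>Exact remainder of this expansion: \<open>d\<close> stands for j and
      \<open>a - d\<close> for pt, so the last term is a multiple of p^2.\<close>
    have "(C - 1) / a - (- 1 / d + 2 * (a - d) / d ^ 2)
        = (1 / a) * (C - (a - d) / d) - 2 * (a - d) * (a - d) / (d * d * a)" if "d \<noteq> 0" for d
      using that a(1) by (simp add: field_simps power2_eq_square)
    from this[of "of_nat j"] show ?thesis
      using j by (simp add: a_def x_def power2_eq_square)
  qed
  also have "\<dots> \<in> R 2"
    using j t a(2) C by (intro R_add R_p_power_mult R_mult_left R_uminus R_inverse_of_nat) auto
  finally have "S a - S (a - 1) - (- 1 / of_nat j + 2 * x / of_nat j ^ 2) \<in> R 2" .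
  moreover have "S (a - 1) - (- H r + 2 * x * X r) \<in> R 2"
    using Suc by (simp add: a_def x_def j_def mult.assoc)
  moreover have "H j = H r + 1 / of_nat j" "X j = X r + 1 / of_nat j ^ 2"
    by (simp_all add: H_def X_def j_def)
  ultimately show ?case
    using R_add[of "S a - S (a - 1) - (- 1 / of_nat j + 2 * x / of_nat j ^ 2)" 2 "S (a - 1) - (- H r + 2 * x * X r)"]
    unfolding a_def x_def j_def[symmetric] by (simp add: algebra_simps)
qed

section \<open>Fermat quotients from products of residues\<close>

text \<open>Multiplication by n permutes the nonzero residues modulo p.\<close>

lemma prod_mult_mod_p:
  assumes "\<not> p dvd n"
  shows "(\<Prod>k = 1..p - 1. n * k mod p) = fact (p - 1)"
proof -
  have "inj_on (\<lambda>k. n * k mod p) {1..p - 1}"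
  proof (rule inj_onI)
    fix x y assume xy: "x \<in> {1..p - 1}" "y \<in> {1..p - 1}" "n * x mod p = n * y mod p"
    then have "[n * x = n * y] (mod p)" by (simp add: cong_def)
    moreover have "coprime n p"
      by (rule coprime_commute[THEN iffD1]) (rule prime_imp_coprime[OF prime_p assms])
    ultimately have "[x = y] (mod p)" by (rule cong_mult_lcancel_nat[THEN iffD1, rotated])
    then show "x = y"
      by (rule cong_less_modulus_unique_nat) (use xy(1,2) p_gt_3 in auto)
  qed
  moreover have "(\<lambda>k. n * k mod p) ` {1..p - 1} \<subseteq> {1..p - 1}"
  proof
    fix y assume "y \<in> (\<lambda>k. n * k mod p) ` {1..p - 1}"
    then obtain k where "k \<in> {1..p - 1}" and y: "y = n * k mod p" by blast
    then have k: "0 < k" "k < p" by auto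
    have "\<not> p dvd n * k"
      using not_p_dvd[OF k(1,2)] assms prime_p by (simp add: prime_dvd_mult_iff)
    then have "y \<noteq> 0" unfolding y mod_eq_0_iff_dvd .
    moreover have "y < p" unfolding y using p_gt_3 by simp
    ultimately show "y \<in> {1..p - 1}" by simp
  qed
  ultimately have "bij_betw (\<lambda>k. n * k mod p) {1..p - 1} {1..p - 1}"
    unfolding bij_betw_def by (intro conjI endo_inj_surj) auto
  from prod.reindex_bij_betw[OF this, of "\<lambda>k. k"] show ?thesis
    by (simp only: fact_prod of_nat_id)
qed

text \<open>By Newton's identity half the difference of the squared sum and the sum of squares is
  the second elementary symmetric polynomial; the later ones carry p^3.\<close>

lemma prod_one_minus_p_mult:
  assumes "finite A" "\<And>k. k \<in> A \<Longrightarrow> x k \<in> R 0"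
  shows "(\<Prod>k \<in> A. 1 - of_nat p * x k) - (1 - of_nat p * sum x A
    + of_nat p ^ 2 * (sum x A ^ 2 - (\<Sum>k \<in> A. x k ^ 2)) / 2) \<in> R 3"
  using assms
proof (induction A)
  case (insert i A)
  define e s P where "e = sum x A" and "s = (\<Sum>k \<in> A. x k ^ 2)" and "P = (\<Prod>k \<in> A. 1 - of_nat p * x k)"
  have e: "e \<in> R 0" unfolding e_def using insert.prems by (intro R_sum) auto
  have s: "s \<in> R 0" unfolding s_def using insert.prems by (intro R_sum R_power) auto
  have x: "x i \<in> R 0" using insert.prems by auto
  have IH: "P - (1 - of_nat p * e + of_nat p ^ 2 * (e ^ 2 - s) / 2) \<in> R 3"
    using insert unfolding e_def s_def P_def by auto
  have "(1 - of_nat p * x i) * P - (1 - of_nat p * (x i + e)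
      + of_nat p ^ 2 * ((x i + e) ^ 2 - (x i ^ 2 + s)) / 2)
     = (1 - of_nat p * x i) * (P - (1 - of_nat p * e + of_nat p ^ 2 * (e ^ 2 - s) / 2))
       - of_nat p ^ 3 * (x i * ((e ^ 2 - s) / of_nat 2))"
    by (simp add: field_simps power2_eq_square power3_eq_cube)
  also have "\<dots> \<in> R 3"
    using R_mult[OF R_of_nat x, of p]
    by (intro R_diff R_mult_left R_p_power_mult IH R_divide_of_nat not_p_dvd_2_3 R_power x e s R_1) simp
  finally show ?case using insert.hyps by (simp add: e_def s_def P_def)
qed simp

text \<open>The \<open>p\<close>-adic logarithm of \<open>n\<^sup>p\<^sup>-\<^sup>1 = 1 + p q\<^sub>p(n)\<close>, divided by \<open>p\<close> and truncated modulo \<open>p\<^sup>2\<close>.\<close>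

definition lq :: "nat \<Rightarrow> rat" where
  "lq n = fermat_quotient p (int n) - of_nat p * fermat_quotient p (int n) ^ 2 / 2"

lemma R_fermat_quotient:
  assumes "\<not> p dvd n"
  shows "fermat_quotient p (int n) \<in> R 0"
proof -
  have "[n ^ (p - 1) = 1] (mod p)" using assms prime_p by (intro fermat_theorem)
  then have "int p dvd int n ^ (p - 1) - 1"
    by (metis cong_iff_dvd_diff cong_int_iff of_nat_1 of_nat_power)
  then have "of_int (int n ^ (p - 1) - 1) \<in> R (Suc 0)" unfolding of_int_R_1_iff .
  moreover have "of_int (int n ^ (p - 1) - 1) = of_nat p * fermat_quotient p (int n)"
    by (simp add: fermat_quotient_def)
  ultimately show ?thesis by (metis R_Suc_iff)
qed

text \<open>Division with remainder gives n k (1 - p x_k) = n k mod p. Multiplying over k and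
  cancelling (p - 1)! yields (1 + pq) P = 1 with P the product of the 1 - p x_k; the claim is the
  logarithm of this identity, divided by p.\<close>

lemma lq_cong:
  assumes n: "\<not> p dvd n"
  defines "x \<equiv> \<lambda>k. of_nat (n * k div p) / (of_nat n * of_nat k)"
  shows "lq n - ((\<Sum>k = 1..p - 1. x k) + of_nat p * (\<Sum>k = 1..p - 1. x k ^ 2) / 2) \<in> R 2"
proof -
  define e s P where "e = (\<Sum>k = 1..p - 1. x k)" and "s = (\<Sum>k = 1..p - 1. x k ^ 2)"
    and "P = (\<Prod>k = 1..p - 1. 1 - of_nat p * x k)"
  define q where "q = fermat_quotient p (int n)"
  have "n \<noteq> 0" using n by (metis dvd_0_right)
  have x: "x k \<in> R 0" if "k \<in> {1..p - 1}" for k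
  proof -
    have "\<not> p dvd n * k"
      using not_p_dvd[of k] that n prime_p p_gt_3 by (simp add: prime_dvd_mult_iff) linarith
    from R_divide_of_nat[OF R_of_nat this, of "n * k div p"] show ?thesis by (simp add: x_def)
  qed
  have e: "e \<in> R 0" unfolding e_def by (intro R_sum x)
  have s: "s \<in> R 0" unfolding s_def by (intro R_sum R_power x)
  have q: "q \<in> R 0" unfolding q_def by (rule R_fermat_quotient[OF n])
  have P: "P - (1 - of_nat p * e + of_nat p ^ 2 * (e ^ 2 - s) / 2) \<in> R 3"
    unfolding P_def e_def s_def by (intro prod_one_minus_p_mult x) auto
  have q_eq: "of_nat n ^ (p - 1) = 1 + of_nat p * q"
    by (simp add: q_def fermat_quotient_def)
  have "of_nat n * of_nat k * (1 - of_nat p * x k) = of_nat (n * k mod p)" if "k \<in> {1..p - 1}" for k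
  proof -
    have "of_nat n * of_nat k = (of_nat (n * k div p) * of_nat p + of_nat (n * k mod p) :: rat)"
      by (metis div_mult_mod_eq of_nat_add of_nat_mult)
    moreover have "of_nat n * of_nat k * (1 - of_nat p * x k) = of_nat n * of_nat k - of_nat (n * k div p) * of_nat p"
      using that \<open>n \<noteq> 0\<close> by (simp add: x_def right_diff_distrib)
    ultimately show ?thesis by simp
  qed
  then have "(\<Prod>k = 1..p - 1. of_nat n * of_nat k * (1 - of_nat p * x k)) = (\<Prod>k = 1..p - 1. of_nat (n * k mod p))"
    by (intro prod.cong) auto
  also have "\<dots> = fact (p - 1)"
    unfolding of_nat_prod[symmetric] prod_mult_mod_p[OF n] by simp
  finally have "(\<Prod>k = 1..p - 1. of_nat n * of_nat k * (1 - of_nat p * x k)) = fact (p - 1)" .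
  moreover have "(\<Prod>k = 1..p - 1. of_nat n * of_nat k * (1 - of_nat p * x k))
      = of_nat n ^ (p - 1) * fact (p - 1) * P"
    unfolding P_def by (simp only: prod.distrib) (simp add: fact_prod)
  ultimately have "of_nat n ^ (p - 1) * fact (p - 1) * P = fact (p - 1)" by simp
  then have unit: "(1 + of_nat p * q) * P = 1" unfolding q_eq by simp
  \<comment> \<open>\<open>p z = (1 + p q) Q - 1\<close>, where \<open>Q\<close> is the expansion of \<open>P\<close> modulo \<open>p\<^sup>3\<close>.\<close>
  define z where "z = q - e - of_nat p * q * e + of_nat p * ((1 + of_nat p * q) * (e ^ 2 - s)) / of_nat 2"
  have "(1 + of_nat p * q) * (P - (1 - of_nat p * e + of_nat p ^ 2 * (e ^ 2 - s) / 2))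
      = of_nat p * - z"
    unfolding right_diff_distrib unit z_def by (simp add: field_simps power2_eq_square)
  moreover have pq: "1 + of_nat p * q \<in> R 0" using q by (intro R_add R_mult_left) auto
  ultimately have "of_nat p * - z \<in> R 3"
    using R_mult_left[OF pq P] by simp
  then have "- z \<in> R 2" unfolding numeral_3_eq_3 R_Suc_iff by (simp add: numeral_2_eq_2)
  then have z: "z \<in> R 2" using R_uminus by fastforce
  \<comment> \<open>First only modulo p: all of z except q - e carries a factor p, hence q = e
    modulo p.\<close>
  have "of_nat p * (q * e - ((1 + of_nat p * q) * (e ^ 2 - s)) / of_nat 2) \<in> R (Suc 0)"
    unfolding R_Suc_iff
    by (intro R_diff R_mult_left R_divide_of_nat not_p_dvd_2_3 pq R_power q e s)
  with R_Suc_subset[of z 1] z have "z + of_nat p * (q * e - ((1 + of_nat p * q) * (e ^ 2 - s)) / of_nat 2) \<in> R (Suc 0)"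
    by (intro R_add) (auto simp: numeral_2_eq_2)
  then have qe: "q - e \<in> R (Suc 0)"
    by (rule R_eqI) (simp add: z_def algebra_simps)
  \<comment> \<open>Bootstrapping: since q = e modulo p, the term p (q - e)^2/2 may be subtracted;
    it turns -pqe + p e^2/2 into -p q^2/2.\<close>
  have "of_nat p * ((q - e) * (q - e)) \<in> R 2"
    using R_mult_right[OF qe R_diff[OF q e]] by (simp add: numeral_2_eq_2)
  then have "of_nat p * ((q - e) * (q - e)) / of_nat 2 \<in> R 2"
    by (rule R_divide_of_nat[OF _ not_p_dvd_2_3(1)])
  moreover have "of_nat p ^ 2 * (q * ((e ^ 2 - s) / of_nat 2)) \<in> R 2"
    by (intro R_p_power_mult R_diff R_mult_left R_divide_of_nat not_p_dvd_2_3 R_power q e s)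
  ultimately have "z - of_nat p * ((q - e) * (q - e)) / of_nat 2 - of_nat p ^ 2 * (q * ((e ^ 2 - s) / of_nat 2)) \<in> R 2"
    using z by (intro R_diff)
  then have "lq n - (e + of_nat p * s / 2) \<in> R 2"
    by (rule R_eqI) (simp add: lq_def q_def[symmetric] z_def field_simps power2_eq_square)
  then show ?thesis unfolding e_def s_def .
qed

section \<open>H at p/2, p/3 and p/6 through Fermat quotients\<close>

text \<open>For n = 2 the floor of 2k/p is 0 up to (p - 1)/2 and 1 beyond, so \<open>lq_cong\<close>
  involves only H and X at p - 1 and (p - 1)/2; of these only H at (p - 1)/2 survives modulo
  p^2.\<close>

lemma H_half: "H ((p - 1) div 2) + 2 * lq 2 \<in> R 2"
proof -
  have split: "(\<Sum>k = 1..p - 1. of_nat (2 * k div p) ^ i * g k)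
      = (\<Sum>k = 1..p - 1. g k) - (\<Sum>k = 1..(p - 1) div 2. g k :: rat)" if "i > 0" for g i
  proof -
    have "2 * k div p = (if k \<le> (p - 1) div 2 then 0 else 1)" if "k \<in> {1..p - 1}" for k
      using that p_gt_3 by (auto intro: div_nat_eqI)
    then have "(\<Sum>k = 1..p - 1. of_nat (2 * k div p) ^ i * g k)
        = (\<Sum>k = 1..p - 1. if k \<le> (p - 1) div 2 then 0 else g k)"
      using \<open>i > 0\<close> by (intro sum.cong) auto
    also have "\<dots> = (\<Sum>k = Suc ((p - 1) div 2)..p - 1. g k)"
      by (rule sum.mono_neutral_cong_right) auto
    finally show ?thesis by (subst (asm) sum_interval_diff) auto
  qed
  define x where "x = (\<lambda>k. of_nat (2 * k div p) / (of_nat 2 * of_nat k) :: rat)"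
  have "(\<Sum>k = 1..p - 1. x k) = (\<Sum>k = 1..p - 1. of_nat (2 * k div p) ^ 1 * (1 / of_nat k)) / 2"
    by (simp add: sum_divide_distrib x_def mult.commute)
  also have "\<dots> = (H (p - 1) - H ((p - 1) div 2)) / 2" unfolding H_def by (subst split) auto
  finally have e: "(\<Sum>k = 1..p - 1. x k) = (H (p - 1) - H ((p - 1) div 2)) / 2" .
  have "(\<Sum>k = 1..p - 1. x k ^ 2) = (\<Sum>k = 1..p - 1. of_nat (2 * k div p) ^ 2 * (1 / of_nat k ^ 2)) / 4"
    by (simp add: sum_divide_distrib x_def power_divide power_mult_distrib mult.commute)
  also have "\<dots> = (X (p - 1) - X ((p - 1) div 2)) / 4" unfolding X_def by (subst split) auto
  finally have s: "(\<Sum>k = 1..p - 1. x k ^ 2) = (X (p - 1) - X ((p - 1) div 2)) / 4" .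
  have l: "lq 2 - ((\<Sum>k = 1..p - 1. x k) + of_nat p * (\<Sum>k = 1..p - 1. x k ^ 2) / 2) \<in> R 2"
    unfolding x_def by (rule lq_cong[OF not_p_dvd_2_3(1)])
  have p4: "\<not> p dvd 4"
    using not_p_dvd_2_power_3_power[of 2 0] by simp
  have X: "of_nat p * (X (p - 1) - X ((p - 1) div 2)) / of_nat 4 \<in> R 2"
    using R_diff[OF X_p_minus_1 X_half] by (intro R_divide_of_nat p4) (simp add: numeral_2_eq_2)
  \<comment> \<open>The numeral \<open>num.Bit0 num.One\<close> is 2: the congruence for
    \<open>lq 2\<close> is doubled and the vanishing sums are added back.\<close>
  from R_add[OF R_add[OF R_mult_left[OF R_numeral[of "num.Bit0 num.One"] l] H_p_minus_1] X] show ?thesis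
    unfolding e s by (rule R_eqI) (simp add: field_simps)
qed

text \<open>For n = 3 the floor of 3k/p jumps after a = p div 3 and after b = p - 1 - a. Reflection
  expresses H(b) and X(b) by H(a) and X(a).\<close>

lemma H_third: "H (p div 3) + 3 / 2 * lq 3 + of_nat p * X (p div 3) / 3 \<in> R 2"
proof -
  define a b where "a = p div 3" and "b = p - 1 - a"
  have ab: "a \<le> b" "b \<le> p - 1" "a < p" using p_gt_3 by (auto simp: a_def b_def)
  have p3: "p = 3 * a + 1 \<or> p = 3 * a + 2"
    unfolding a_def by (rule p_mod_6) auto
  have split: "(\<Sum>k = 1..p - 1. of_nat (3 * k div p) ^ i * g k)
      = 2 ^ i * ((\<Sum>k = 1..p - 1. g k) - (\<Sum>k = 1..b. g k))
        + ((\<Sum>k = 1..b. g k) - (\<Sum>k = 1..a. g k :: rat))" if "i > 0" for g i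
  proof -
    have f: "3 * k div p = (if k \<le> a then 0 else if k \<le> b then 1 else 2)" if "k \<in> {1..p - 1}" for k
      using that p3 by (auto simp: b_def intro!: div_nat_eqI)
    have "{1..p - 1} = {1..a} \<union> {Suc a..b} \<union> {Suc b..p - 1}" using ab by auto
    then have "(\<Sum>k = 1..p - 1. of_nat (3 * k div p) ^ i * g k)
        = (\<Sum>k = 1..a. of_nat (3 * k div p) ^ i * g k) + (\<Sum>k = Suc a..b. of_nat (3 * k div p) ^ i * g k)
          + (\<Sum>k = Suc b..p - 1. of_nat (3 * k div p) ^ i * g k)"
      using ab by (simp add: sum.union_disjoint disjoint_iff)
    also have "(\<Sum>k = 1..a. of_nat (3 * k div p) ^ i * g k) = 0"
      using ab f \<open>i > 0\<close> by (intro sum.neutral) auto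
    also have "(\<Sum>k = Suc a..b. of_nat (3 * k div p) ^ i * g k) = (\<Sum>k = Suc a..b. g k)"
      using ab f by (intro sum.cong) auto
    also have "(\<Sum>k = Suc b..p - 1. of_nat (3 * k div p) ^ i * g k) = 2 ^ i * (\<Sum>k = Suc b..p - 1. g k)"
      unfolding sum_distrib_left using ab f by (intro sum.cong) auto
    finally show ?thesis
      by (simp only: sum_interval_diff[OF ab(1)] sum_interval_diff[OF ab(2)] add_0 add.commute)
  qed
  define x where "x = (\<lambda>k. of_nat (3 * k div p) / (of_nat 3 * of_nat k) :: rat)"
  have "(\<Sum>k = 1..p - 1. x k) = (\<Sum>k = 1..p - 1. of_nat (3 * k div p) ^ 1 * (1 / of_nat k)) / 3"
    by (simp add: sum_divide_distrib x_def mult.commute)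
  also have "\<dots> = (2 * (H (p - 1) - H b) + (H b - H a)) / 3" unfolding H_def by (subst split) auto
  finally have e: "(\<Sum>k = 1..p - 1. x k) = (2 * (H (p - 1) - H b) + (H b - H a)) / 3" .
  have "(\<Sum>k = 1..p - 1. x k ^ 2) = (\<Sum>k = 1..p - 1. of_nat (3 * k div p) ^ 2 * (1 / of_nat k ^ 2)) / 9"
    by (simp add: sum_divide_distrib x_def power_divide power_mult_distrib mult.commute)
  also have "\<dots> = (4 * (X (p - 1) - X b) + (X b - X a)) / 9" unfolding X_def by (subst split) auto
  finally have s: "(\<Sum>k = 1..p - 1. x k ^ 2) = (4 * (X (p - 1) - X b) + (X b - X a)) / 9" .
  have l: "lq 3 - ((\<Sum>k = 1..p - 1. x k) + of_nat p * (\<Sum>k = 1..p - 1. x k ^ 2) / 2) \<in> R 2"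
    unfolding x_def by (rule lq_cong[OF not_p_dvd_2_3(2)])
  have H: "H b - (H a + of_nat p * X a) \<in> R 2" unfolding b_def by (rule H_reflect[OF ab(3)])
  have X: "X b + X a \<in> R 1" unfolding b_def by (rule X_reflect'[OF ab(3)])
  have p12: "\<not> p dvd 12" "\<not> p dvd 2"
    using not_p_dvd_2_power_3_power[of 2 1] not_p_dvd_2_power_3_power[of 1 0] by simp_all
  have X': "of_nat p * (4 * X (p - 1) - 3 * (X b + X a)) / of_nat 12 \<in> R 2"
    using R_diff[OF R_mult_left[of 4, OF _ X_p_minus_1] R_mult_left[of 3, OF _ X]]
    by (intro R_divide_of_nat p12) (simp add: numeral_2_eq_2)
  have l': "(3 * (lq 3 - ((\<Sum>k = 1..p - 1. x k) + of_nat p * (\<Sum>k = 1..p - 1. x k ^ 2) / 2))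
      - (H b - (H a + of_nat p * X a))) / of_nat 2 \<in> R 2"
    by (intro R_divide_of_nat R_diff R_mult_left l H p12) auto
  from R_add[OF R_add[OF l' H_p_minus_1] X'] show ?thesis
    unfolding e s a_def[symmetric] by (rule R_eqI) (simp add: field_simps)
qed

text \<open>The X terms of \<open>H_sixth\<close> and \<open>H_third\<close> have coefficients 1/2 +
  1/3 = 5/6, and 5 X(p div 3) is X(p div 6) modulo p.\<close>

lemma H_sixth_lq:
  "H (p div 6) + 2 * lq 2 + 3 / 2 * lq 3 + of_nat p * X (p div 6) / 6 \<in> R 2"
proof -
  have p6: "\<not> p dvd 6"
    using not_p_dvd_2_power_3_power[of 1 1] by simp
  have "of_nat p * (X (p div 6) - 5 * X (p div 3)) / of_nat 6 \<in> R 2"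
    using X_sixth by (intro R_divide_of_nat p6) (simp add: numeral_2_eq_2)
  from R_add[OF R_add[OF H_sixth this] R_add[OF H_half H_third]] show ?thesis
    by (rule R_eqI) (simp add: field_simps)
qed

section \<open>The sum X at p/6 and U at p - 3\<close>

lemma R_cong_power: "x - y \<in> R m \<Longrightarrow> x \<in> R 0 \<Longrightarrow> y \<in> R 0 \<Longrightarrow> x ^ n - y ^ n \<in> R m"
  using R_cong_prod[of "{..<n}" "\<lambda>_. x" "\<lambda>_. y"] by simp

text \<open>Fermat's little theorem divided by y^2; it turns the power sums telescoped by
  \<open>G\<close> into sums of inverse squares.\<close>

lemma power_p_minus_3:
  assumes "0 < y" "y < p"
  shows "of_nat y ^ (p - 3) - 1 / of_nat y ^ 2 \<in> R 1"
proof -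
  have "y \<noteq> 0" using assms by simp
  have fq: "of_nat p * fermat_quotient p (int y) = of_nat y ^ (p - 1) - 1"
    by (simp add: fermat_quotient_def)
  have "of_nat p * fermat_quotient p (int y) * (1 / of_nat y) * (1 / of_nat y) \<in> R 1"
    using R_fermat_quotient[OF not_p_dvd[OF assms]]
    by (intro R_mult_right[of _ 1] R_inverse_of_nat assms) simp_all
  moreover have "p - 1 = (p - 3) + 2" using p_gt_3 by simp
  then have "of_nat y ^ (p - 1) = (of_nat y ^ (p - 3) * of_nat y ^ 2 :: rat)"
    by (metis power_add)
  then have "of_nat y ^ (p - 3) - 1 / of_nat y ^ 2
      = of_nat p * fermat_quotient p (int y) * (1 / of_nat y) * (1 / of_nat y)"
    unfolding fq using \<open>y \<noteq> 0\<close> by (simp add: diff_divide_distrib power2_eq_square)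
  ultimately show ?thesis by simp
qed

lemma G_p: "G n (of_nat p) - of_int (U_seq n) \<in> R 1"
proof -
  have "of_nat p ^ i - 0 ^ i \<in> R 1" for i
    by (rule R_cong_power) simp_all
  then have "G n (of_nat p) - G n 0 \<in> R 1"
    unfolding G_sum by (intro R_cong_sum) (simp only: right_diff_distrib[symmetric] R_mult_left R_of_int)
  then show ?thesis by (simp add: G_0)
qed

text \<open>The condition \<open>3 N + 2 c = p + 3\<close> says that \<open>j \<mapsto> N - 1 - j\<close> sends \<open>3 j + c\<close> to \<open>p - (3 j + c)\<close>.\<close>

lemma alternating_sum_reflect:
  assumes "even N" "even n" "3 * N + 2 * c = p + 3"
  shows "(\<Sum>j < N. (- 1) ^ j * of_nat (3 * j + c) ^ n) \<in> R 1"
proof -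
  define T :: rat where "T = (\<Sum>j < N. (- 1) ^ j * of_nat (3 * j + c) ^ n)"
  have "T = (\<Sum>j < N. (- 1) ^ (N - Suc j) * of_nat (3 * (N - Suc j) + c) ^ n)"
    unfolding T_def by (rule sum.nat_diff_reindex[symmetric])
  also have "\<dots> = (\<Sum>j < N. - ((- 1) ^ j * (of_nat p - of_nat (3 * j + c)) ^ n))"
  proof (rule sum.cong)
    fix j assume j: "j \<in> {..<N}"
    then obtain i where i: "N = Suc j + i" by (auto dest: less_imp_Suc_add)
    have "p = 3 * i + c + (3 * j + c)" using assms(3) i by simp
    then have "of_nat p = (of_nat (3 * i + c) + of_nat (3 * j + c) :: rat)"
      by (metis of_nat_add)
    moreover have "(- 1 :: rat) ^ i = - ((- 1) ^ j)"
      using assms(1) i by (auto simp: minus_one_power_iff)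
    ultimately show "(- 1) ^ (N - Suc j) * of_nat (3 * (N - Suc j) + c) ^ n
        = - ((- 1) ^ j * (of_nat p - of_nat (3 * j + c) :: rat) ^ n)"
      by (simp add: i) (simp add: add.commute)
  qed simp
  finally have "T = - (\<Sum>j < N. (- 1) ^ j * (of_nat p - of_nat (3 * j + c)) ^ n)"
    unfolding sum_negf .
  \<comment> \<open>For even n, (p - y)^n = y^n modulo p, so T is congruent to its own
    negative.\<close>
  then have "2 * T = T - (\<Sum>j < N. (- 1) ^ j * (of_nat p - of_nat (3 * j + c)) ^ n)"
    by simp
  also have "\<dots> \<in> R 1"
    unfolding T_def
  proof (rule R_cong_sum)
    fix j
    have "(of_nat p - of_nat (3 * j + c)) ^ n - (- of_nat (3 * j + c)) ^ n \<in> R 1"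
      by (rule R_cong_power[OF _ R_diff[OF R_of_nat R_of_nat] R_uminus[OF R_of_nat]]) simp
    then have "of_nat (3 * j + c) ^ n - (of_nat p - of_nat (3 * j + c)) ^ n \<in> R 1"
      unfolding uminus_power_if if_P[OF assms(2)] by (rule R_cong_sym)
    from R_mult_left[OF R_power[OF R_uminus[OF R_1]] this, of j]
    show "(- 1) ^ j * of_nat (3 * j + c) ^ n - (- 1) ^ j * (of_nat p - of_nat (3 * j + c)) ^ n \<in> R 1"
      by (rule R_eqI) (rule right_diff_distrib[symmetric])
  qed
  finally show ?thesis
    using R_divide_of_nat[OF _ not_p_dvd_2_3(1), of "2 * T" 1] by (simp add: T_def)
qed

text \<open>Euler's criterion splits off (-1)^h with h = (p - 1)/2, and quadratic reciprocity for 3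
  and p absorbs that sign, leaving the symbol of p modulo 3.\<close>

lemma Legendre_minus_3: "Legendre (- 3) (int p) = (if p mod 3 = 1 then 1 else - 1)"
proof -
  define h where "h = (p - 1) div 2"
  have Legendre_cases: "Legendre a b \<in> {- 1, 0, 1}" for a b by (simp add: Legendre_def)
  have "[Legendre (int p) (int 3) = int p ^ ((3 - 1) div 2)] (mod int 3)"
    by (rule euler_criterion) auto
  then have "Legendre (int p) 3 mod 3 = int p mod 3" by (simp add: cong_def)
  moreover have "p mod 3 = 1 \<or> p mod 3 = 2"
    by (rule p_mod_6) simp_all
  ultimately have p3: "Legendre (int p) 3 = (if p mod 3 = 1 then 1 else - 1)"
  proof -
    have "l = (if p mod 3 = 1 then 1 else - 1)"
      if "l mod 3 = int p mod 3" "p mod 3 = 1 \<or> p mod 3 = 2" "l = - 1 \<or> l = 0 \<or> l = 1" for l :: int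
      using that zmod_int[of p 3] by (elim disjE) simp_all
    then show "Legendre (int p) 3 mod 3 = int p mod 3 \<Longrightarrow> p mod 3 = 1 \<or> p mod 3 = 2 \<Longrightarrow> ?thesis"
      using Legendre_cases[of "int p" 3] by auto
  qed
  have "Legendre (int p) (int 3) * Legendre (int 3) (int p) = (- 1) ^ ((p - 1) div 2 * ((3 - 1) div 2))"
    using p_gt_3 prime_p by (intro Quadratic_Reciprocity) auto
  then have QR: "Legendre (int p) 3 * Legendre 3 (int p) = (- 1) ^ h"
    by (simp add: h_def)
  have "[Legendre (- 3) (int p) = (- 3) ^ h] (mod int p)"
    and "[Legendre 3 (int p) = 3 ^ h] (mod int p)"
    using euler_criterion[OF prime_p] p_gt_3 unfolding h_def by auto
  moreover have "(- 3 :: int) ^ h = (- 1) ^ h * 3 ^ h"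
    by (simp add: power_mult_distrib[symmetric])
  ultimately have "[Legendre (- 3) (int p) = (- 1) ^ h * Legendre 3 (int p)] (mod int p)"
    by (metis cong_scalar_left cong_sym cong_trans)
  also have "(- 1) ^ h * Legendre 3 (int p) = Legendre (int p) 3"
    using QR p3 by (cases "even h") (auto split: if_splits)
  finally have "int p dvd Legendre (- 3) (int p) - Legendre (int p) 3"
    by (simp add: cong_iff_dvd_diff)
  \<comment> \<open>Both symbols lie in {-1, 0, 1}, so their difference is at most 2 in absolute
    value, which is less than p.\<close>
  then have "Legendre (- 3) (int p) - Legendre (int p) 3 = 0"
    using Legendre_cases[of "- 3" "int p"] Legendre_cases[of "int p" 3] p_gt_3
      dvd_imp_le_int[of "Legendre (- 3) (int p) - Legendre (int p) 3" "int p"]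
    by (cases "Legendre (- 3) (int p) - Legendre (int p) 3 = 0") auto
  then show ?thesis using p3 by simp
qed

text \<open>The alternating sum A is evaluated twice modulo p: telescoping through \<open>G\<close>
  gives L U/2, and Fermat gives (X(p div 6)/2 - X(p div 3))/9.\<close>

lemma X_sixth_U:
  "X (p div 6) - 15 * of_int (Legendre (- 3) (int p)) * of_int (U_seq (p - 3)) \<in> R 1"
proof -
  define n a where "n = p - 3" and "a = p div 3"
  define L U :: rat where "L = of_int (Legendre (- 3) (int p))" and "U = of_int (U_seq n)"
  define A :: rat where "A = (\<Sum>l = 1..a. (- 1) ^ l * of_nat (3 * l) ^ n)"
  have n: "even n" "n > 0" using even_p_minus_1 p_gt_3 by (auto simp: n_def)
  have U: "U \<in> R 0" unfolding U_def by (rule R_of_int)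
  have Gp: "G n (of_nat p) - U \<in> R 1" unfolding U_def by (rule G_p)
  have A_L: "A - L * U / 2 \<in> R 1"
  proof (rule p_mod_6)
    fix m assume m: "p = 6 * m + 1" "p div 3 = 2 * m" "p mod 3 = 1"
    have L: "L = 1" by (simp add: L_def Legendre_minus_3 m(3))
    have a: "a = 2 * m" by (simp add: a_def m)
    define T :: rat where "T = (\<Sum>j < a. (- 1) ^ j * of_nat (3 * j + 2) ^ n)"
    have T: "T \<in> R 1" unfolding T_def
      by (rule alternating_sum_reflect[OF _ n(1)]) (auto simp: m a)
    have A: "A = - (\<Sum>j < a. (- 1) ^ j * of_nat (3 * j + 3) ^ n)"
      unfolding A_def One_nat_def sum.atLeast1_atMost_eq sum_negf[symmetric]
      by (intro sum.cong) (simp_all add: add.commute)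
    \<comment> \<open>Start x = 1: the terms 3j + 3 form -A after the shift l = j + 1, the terms 3j
      + 2 form T, and the end point 1 + 3a is p.\<close>
    have "T - A = (\<Sum>j < a. (- 1) ^ j * ((1 + 3 * of_nat j + 1) ^ n + (1 + 3 * of_nat j + 2) ^ n))"
      unfolding T_def A by (simp add: sum.distrib[symmetric] algebra_simps)
    also have "\<dots> = G n 1 - (- 1) ^ a * G n (1 + 3 * of_nat a)"
      by (rule alternating_sum_G)
    also have "1 + 3 * of_nat a = (of_nat p :: rat)" by (simp add: m a)
    finally have "T - A = U / 2 - G n (of_nat p)" using G_1[OF n] by (simp add: a U_def)
    then have "A - L * U / 2 = T + (G n (of_nat p) - U)" by (simp add: L field_simps)
    with R_add[OF T Gp] show ?thesis by (simp only:)
  next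
    fix m assume m: "p = 6 * m + 5" "p div 3 = 2 * m + 1" "p mod 3 = 2"
    have L: "L = - 1" by (simp add: L_def Legendre_minus_3 m(3))
    have a: "a = 2 * m + 1" by (simp add: a_def m)
    define T :: rat where "T = (\<Sum>j < Suc a. (- 1) ^ j * of_nat (3 * j + 1) ^ n)"
    have T: "T \<in> R 1" unfolding T_def
      by (rule alternating_sum_reflect[OF _ n(1)]) (auto simp: m a)
    \<comment> \<open>The added term at 0 is 0^n = 0, since n > 0.\<close>
    have A: "A = (\<Sum>j < Suc a. (- 1) ^ j * of_nat (3 * j) ^ n)"
      unfolding A_def lessThan_Suc_atMost atMost_atLeast0
      using n(2) by (simp add: sum.atLeast_Suc_atMost)
    \<comment> \<open>Start x = -1: the terms are now 3j and 3j + 1, and a + 1 steps of length 3 end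
      at p.\<close>
    have "A + T = (\<Sum>j < Suc a. (- 1) ^ j * ((- 1 + 3 * of_nat j + 1) ^ n + (- 1 + 3 * of_nat j + 2) ^ n))"
      unfolding T_def A sum.distrib[symmetric] by (intro sum.cong) (simp_all add: algebra_simps)
    also have "\<dots> = G n (- 1) - (- 1) ^ Suc a * G n (- 1 + 3 * of_nat (Suc a))"
      by (rule alternating_sum_G)
    also have "- 1 + 3 * of_nat (Suc a) = (of_nat p :: rat)" by (simp add: m a)
    finally have "A + T = U / 2 - G n (of_nat p)"
      using G_1[OF n] G_uminus[OF n(1), of 1] by (simp add: a U_def)
    then have "A - L * U / 2 = - (T + (G n (of_nat p) - U))" by (simp add: L field_simps)
    with R_uminus[OF R_add[OF T Gp]] show ?thesis by (simp only:)
  qed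
  have "A - (\<Sum>l = 1..a. (- 1) ^ l * (1 / of_nat (3 * l) ^ 2)) \<in> R 1"
    unfolding A_def n_def
  proof (rule R_cong_sum)
    fix l assume "l \<in> {1..a}"
    moreover have "3 * a < p" unfolding a_def by (rule p_mod_6) auto
    ultimately have l: "0 < 3 * l" "3 * l < p" by auto
    from R_mult_left[OF R_power[OF R_uminus[OF R_1]] power_p_minus_3[OF l], of l]
    show "(- 1) ^ l * of_nat (3 * l) ^ (p - 3) - (- 1) ^ l * (1 / of_nat (3 * l) ^ 2) \<in> R 1"
      by (rule R_eqI) (rule right_diff_distrib[symmetric])
  qed
  also have "(\<Sum>l = 1..a. (- 1) ^ l * (1 / of_nat (3 * l) ^ 2 :: rat)) = (X (a div 2) / 2 - X a) / 9"
  proof -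
    have eqs: "(\<Sum>l = 1..b. 1 / of_nat (3 * (2 * l)) ^ 2) = X b / 36"
      "(\<Sum>l = 1..b. 1 / of_nat (3 * l) ^ 2) = X b / 9" for b
      unfolding X_def sum_divide_distrib by (simp_all add: power_mult_distrib mult.commute)
    show ?thesis unfolding alternating_sum_eq eqs by simp
  qed
  also have "a div 2 = p div 6" by (simp add: a_def div_mult2_eq[symmetric])
  finally have A: "A - (X (p div 6) / 2 - X a) / 9 \<in> R 1" .
  have "X (p div 6) - 5 * X a \<in> R 1" unfolding a_def by (rule X_sixth)
  \<comment> \<open>The multipliers 90 and 2 eliminate A and X(a); what remains is 3 (X(p div 6) -
    15 L U).\<close>
  then have "90 * (A - L * U / 2) - (90 * (A - (X (p div 6) / 2 - X a) / 9)
      + 2 * (X (p div 6) - 5 * X a)) \<in> R 1"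
    by (intro R_diff[of "90 * (A - L * U / 2)"] R_add R_mult_left[OF R_numeral] A A_L)
  from R_divide_of_nat[OF this not_p_dvd_2_3(2)] show ?thesis
    unfolding L_def[symmetric] U_def[unfolded n_def, symmetric]
    by (rule R_eqI) (simp add: field_simps)
qed

section \<open>Evaluation at -1/6 and conclusion\<close>

text \<open>Beside the Fermat quotients there remains p X(p div 6) with coefficient -1/6 if p = 1
  modulo 6 and 5/6 if p = 5. By \<open>X_sixth_U\<close> this is -5/2 or -25/2 times p U, and -5/2
  (3 - 2L) covers both signs of L.\<close>

lemma S_minus_sixth:
  "S (- 1 / 6) - (2 * lq 2 + 3 / 2 * lq 3 - 5 / 2 * (3 - 2 * of_int (Legendre (- 3) (int p)))
    * of_nat p * of_int (U_seq (p - 3))) \<in> R 2"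
proof -
  define L U :: rat where "L = of_int (Legendre (- 3) (int p))" and "U = of_int (U_seq (p - 3))"
  define m where "m = p div 6"
  \<comment> \<open>Solves r + pt = -1/6 with 0 \<le> r < p: for p = 6k + 1 one has r = k, for p =
    6k + 5 one has r = 5k + 4 = p - 1 - k.\<close>
  define r t where "r = (if p mod 6 = 1 then m else p - 1 - m)"
    and "t = (if p mod 6 = 1 then - 1 / 6 else - 5 / 6 :: rat)"
  have p6: "\<not> p dvd 6" using not_p_dvd_2_power_3_power[of 1 1] by simp
  have m: "m < p" using p_gt_3 by (simp add: m_def)
  have "t \<in> R 0"
    using R_divide_of_nat[OF R_of_int p6, of "- 1"] R_divide_of_nat[OF R_of_int p6, of "- 5"]
    by (simp add: t_def)
  then have S: "S (of_nat r + of_nat p * t) - (- H r + 2 * of_nat p * t * X r) \<in> R 2"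
    by (rule S_shift) (use m in \<open>auto simp: r_def\<close>)
  have H: "H m + 2 * lq 2 + 3 / 2 * lq 3 + of_nat p * X m / 6 \<in> R 2"
    unfolding m_def by (rule H_sixth_lq)
  have XU: "of_nat p * (X m - 15 * L * U) \<in> R 2"
    using X_sixth_U unfolding m_def L_def U_def by (simp add: numeral_2_eq_2)
  have "S (- 1 / 6) - (2 * lq 2 + 3 / 2 * lq 3 - 5 / 2 * (3 - 2 * L) * of_nat p * U) \<in> R 2"
  proof (rule p_mod_6)
    fix k assume k: "p = 6 * k + 1" "p div 6 = k" "p mod 3 = 1"
    then have mods: "p mod 6 = 1" "p mod 3 = 1" by simp_all
    have L: "L = 1" by (simp add: L_def Legendre_minus_3 mods)
    have rt: "r = m" "t = - 1 / 6" by (simp_all add: r_def t_def mods)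
    have "of_nat r + of_nat p * t = - 1 / 6" by (simp add: rt m_def k(2)) (simp add: k(1) field_simps)
    with S have S': "S (- 1 / 6) - (- H m + 2 * of_nat p * t * X m) \<in> R 2" by (simp add: rt(1))
    show ?thesis
      using R_diff[OF R_diff[OF S' H] R_divide_of_nat[OF XU p6]]
      by (rule R_eqI) (simp add: L rt(2) field_simps)
  next
    fix k assume k: "p = 6 * k + 5" "p div 6 = k" "p mod 3 = 2"
    then have mods: "p mod 6 = 5" "p mod 3 = 2" by simp_all
    have L: "L = - 1" by (simp add: L_def Legendre_minus_3 mods)
    have rt: "r = p - 1 - m" "t = - 5 / 6" by (simp_all add: r_def t_def mods)
    have "r = 5 * k + 4" using k by (simp add: rt m_def)
    then have "of_nat r + of_nat p * t = - 1 / 6" by (simp add: rt(2)) (simp add: k(1) field_simps)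
    with S have S': "S (- 1 / 6) - (- H r + 2 * of_nat p * t * X r) \<in> R 2" by simp
    have Hr: "H r - (H m + of_nat p * X m) \<in> R 2" unfolding rt by (rule H_reflect[OF m])
    have "X r + X m \<in> R 1" unfolding rt by (rule X_reflect'[OF m])
    then have Xr: "of_nat p * (X r + X m) \<in> R 2" by (simp add: numeral_2_eq_2)
    have c: "5 / of_nat 6 \<in> R 0" "5 / of_nat 3 \<in> R 0"
      by (intro R_divide_of_nat p6 not_p_dvd_2_3 R_numeral)+
    show ?thesis
      using R_add[OF R_diff[OF R_diff[OF R_diff[OF S' Hr] H] R_mult_left[OF c(2) Xr]] R_mult_left[OF c(1) XU]]
      by (rule R_eqI) (simp add: L rt(2) field_simps)
  qed
  then show ?thesis by (simp only: L_def U_def)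
qed

lemma rat_congI:
  assumes "x \<in> R 0" "x - y \<in> R 2"
  shows "rat_cong p 2 x y"
proof -
  have "x - y \<in> R 0"
    by (rule R_Suc_subset[OF R_Suc_subset[OF assms(2)[unfolded numeral_2_eq_2]]])
  from R_diff[OF assms(1) this] have "y \<in> R 0" by simp
  moreover have "of_nat p * (of_nat p * ((x - y) / of_nat p ^ 2)) = x - y"
    using of_nat_p_neq_0 by (simp only: power2_eq_square) simp
  with assms(2) have "of_nat p * (of_nat p * ((x - y) / of_nat p ^ 2)) \<in> R 2"
    by (simp only:)
  then have "(x - y) / of_nat p ^ 2 \<in> R 0"
    by (simp only: numeral_2_eq_2 R_Suc_iff)
  ultimately show ?thesis
    using assms(1) by (simp add: rat_cong_def denom_prime_to_iff)
qed

lemma R_S: "a \<in> R 0 \<Longrightarrow> S a \<in> R 0"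
  unfolding S_def
  by (intro R_sum R_mult_left R_gbinomial R_divide_of_nat not_p_dvd R_power R_uminus R_1) auto

end

theorem theorem6p4:
  fixes p :: nat
  assumes "prime p" and "p > 3"
  shows "rat_cong p 2
    (\<Sum>k = 1..p - 1. (-1) ^ k / of_nat k * ((- 1 / 6 :: rat) gchoose k))
    (2 * fermat_quotient p 2 + 3 / 2 * fermat_quotient p 3
     - of_nat p * (fermat_quotient p 2)\<^sup>2 - 3 / 4 * of_nat p * (fermat_quotient p 3)\<^sup>2
     - 5 / 2 * (3 - 2 * of_int (Legendre (- 3) (int p))) * of_nat p * of_int (U_seq (p - 3)))"
proof -
  interpret prime_gt_3 p by standard (use assms in auto)
  have "\<not> p dvd 6" using not_p_dvd_2_power_3_power[of 1 1] by simp
  from R_divide_of_nat[OF R_of_int this, of "- 1"] have "S (- 1 / 6) \<in> R 0"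
    by (intro R_S) simp
  then have "rat_cong p 2 (S (- 1 / 6)) (2 * lq 2 + 3 / 2 * lq 3
     - 5 / 2 * (3 - 2 * of_int (Legendre (- 3) (int p))) * of_nat p * of_int (U_seq (p - 3)))"
    by (rule rat_congI[OF _ S_minus_sixth])
  \<comment> \<open>Unfolding \<open>lq\<close>, the halved squares scaled by 2 and 3/2 give the
    coefficients 1 and 3/4.\<close>
  moreover have "2 * fermat_quotient p 2 + 3 / 2 * fermat_quotient p 3
     - of_nat p * (fermat_quotient p 2)\<^sup>2 - 3 / 4 * of_nat p * (fermat_quotient p 3)\<^sup>2
     - 5 / 2 * (3 - 2 * of_int (Legendre (- 3) (int p))) * of_nat p * of_int (U_seq (p - 3))
     = 2 * lq 2 + 3 / 2 * lq 3
     - 5 / 2 * (3 - 2 * of_int (Legendre (- 3) (int p))) * of_nat p * of_int (U_seq (p - 3))"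
    by (simp add: lq_def right_diff_distrib)
  ultimately show ?thesis by (simp only: S_def)
qed

end
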